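(* Let $d\in\{1,2,3\}$, $t>0$, $g(u)=e^{-\pi|u|^2}$, $u\in\mathbb{R}^d$, and let $T_t$ be the wave multiplier $T_tf=f*\mu_t$ with $d\mu_t(y)=m_t(y)\,dy$. For all $z=(x,\xi)$, $w=(y,\eta)\in\mathbb{R}^{2d}$, $$|\langle T_t\pi(z)g,\pi(w)g\rangle|^2=2^{-d}e^{-\pi|\xi-\eta|^2}\int_{\mathbb{R}^d}e^{-\pi|x-y-u|^2}\left[\int_{\mathbb{R}^d}e^{-\frac\pi4|r|^2}m_t\left(u+\frac r2\right)m_t\left(u-\frac r2\right)e^{-2\pi i r\cdot\frac{\xi+\eta}2}\,dr\right]du.$$
   Context: Fourier transform: $\widehat f(\xi)=\int f(x)e^{-2\pi i x\cdot\xi}dx$. $T_t$ is the Fourier multiplier with symbol $\frac{\sin(2\pi|\xi|t)}{2\pi|\xi|}$. For $d=1$: $d\mu_t(y)=\frac12\chi_{[-t,t]}(y)dy$; for $d=2$: $d\mu_t(y)=(2\pi)^{-1}(t^2-|y|^2)_+^{-1/2}dy$; for $d=3$: $d\mu_t=(4\pi t)^{-1}d\sigma_{\partial B_t(0)}$ (surface measure on the sphere of radius $t$). For $d=3$ the notation $m_t(y)dy$ is formal for the measure $\mu_t$: the product $m_t(u+\frac r2)m_t(u-\frac r2)\,du\,dr$ stands for the image of the measure $d\mu_t(p)\,d\mu_t(q)$ under $u=\frac{p+q}2$, $r=p-q$. Time-frequency shifts: $\pi(x,\xi)f(u)=e^{2\pi i\xi\cdot u}f(u-x)$. $\langle\cdot,\cdot\rangle$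 is the $L^2(\mathbb{R}^d)$ inner product. *)

theory Defs
  imports "HOL-Analysis.Analysis"
begin

definition L2_inner :: "('a::euclidean_space \<Rightarrow> complex) \<Rightarrow> ('a \<Rightarrow> complex) \<Rightarrow> complex"
  where "L2_inner f h = (\<integral>u. f u * cnj (h u) \<partial>lborel)"

definition fourier :: "('a::euclidean_space \<Rightarrow> complex) \<Rightarrow> 'a \<Rightarrow> complex"
  where "fourier f \<xi> = (\<integral>x. f x * cis (- 2 * pi * (x \<bullet> \<xi>)) \<partial>lborel)"

text \<open>The multiplier acts by the absolutely convergent inversion integral, which is the
  \<open>L\<^sup>2\<close> operator on functions whose Fourier transform times the symbol is integrable
  (in particular on time-frequency shifts of a Gaussian).\<close>

definition fourier_multiplier ::
    "('a::euclidean_space \<Rightarrow> complex) \<Rightarrow> ('a \<Rightarrow> complex) \<Rightarrow> 'a \<Rightarrow> complex"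
  where "fourier_multiplier s f x =
    (\<integral>\<xi>. s \<xi> * fourier f \<xi> * cis (2 * pi * (x \<bullet> \<xi>)) \<partial>lborel)"

definition wave_symbol :: "real \<Rightarrow> 'a::euclidean_space \<Rightarrow> real"
  where "wave_symbol t \<xi> =
    (if \<xi> = 0 then t else sin (2 * pi * norm \<xi> * t) / (2 * pi * norm \<xi>))"

definition wave_multiplier ::
    "real \<Rightarrow> ('a::euclidean_space \<Rightarrow> complex) \<Rightarrow> 'a \<Rightarrow> complex"
  where "wave_multiplier t = fourier_multiplier (\<lambda>\<xi>. complex_of_real (wave_symbol t \<xi>))"

text \<open>In dimension 1 the interval \<open>[-t, t]\<close> is the closed ball of radius \<open>t\<close>. In dimension 2,
  \<open>0 powr a = 0\<close> makes the power of the positive part vanish for \<open>norm y \<ge> t\<close>.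
  There is no density in other dimensions; the value 0 is a dummy.\<close>

definition wave_density :: "real \<Rightarrow> 'a::euclidean_space \<Rightarrow> real"
  where "wave_density t y =
    (if DIM('a) = 1 then indicator (cball 0 t) y / 2
     else if DIM('a) = 2 then max 0 (t\<^sup>2 - (norm y)\<^sup>2) powr (- 1 / 2) / (2 * pi)
     else 0)"

text \<open>Surface measure on the sphere of radius \<open>t > 0\<close> as cone measure: by polar coordinates, the
  cone \<open>{s a | a \<in> A, 0 < s < 1}\<close> over a subset \<open>A\<close> of the sphere has Lebesgue measure
  \<open>t / DIM('a)\<close> times the surface area of \<open>A\<close>. The radial projection sends the null set \<open>{0}\<close>
  to \<open>0\<close>.\<close>

definition sphere_measure :: "real \<Rightarrow> 'a::euclidean_space measure"
  where "sphere_measure t =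
    scale_measure (ennreal (real DIM('a) / t))
      (distr (restrict_space lborel (ball 0 t)) borel (\<lambda>y. (t / norm y) *\<^sub>R y))"

definition wave_measure :: "real \<Rightarrow> 'a::euclidean_space measure"
  where "wave_measure t =
    (if DIM('a) = 3 then scale_measure (ennreal (1 / (4 * pi * t))) (sphere_measure t)
     else density lborel (\<lambda>y. ennreal (wave_density t y)))"

definition convolution_measure ::
    "('a::euclidean_space \<Rightarrow> complex) \<Rightarrow> 'a measure \<Rightarrow> 'a \<Rightarrow> complex"
  where "convolution_measure f \<mu> x = (\<integral>y. f (x - y) \<partial>\<mu>)"

text \<open>The image of \<open>\<mu>\<^sub>t \<Otimes> \<mu>\<^sub>t\<close> under \<open>u = (p + q) / 2\<close>, \<open>r = p - q\<close>. In dimension 3 this is the meaning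
  of the formal expression \<open>m\<^sub>t (u + r / 2) m\<^sub>t (u - r / 2) du dr\<close>.\<close>

definition wave_pair_measure :: "real \<Rightarrow> ('a::euclidean_space \<times> 'a) measure"
  where "wave_pair_measure t =
    distr (wave_measure t \<Otimes>\<^sub>M wave_measure t) (borel \<Otimes>\<^sub>M borel)
      (\<lambda>(p, q). ((1 / 2) *\<^sub>R (p + q), p - q))"

fun tf_shift :: "'a::euclidean_space \<times> 'a \<Rightarrow> ('a \<Rightarrow> complex) \<Rightarrow> 'a \<Rightarrow> complex"
  where "tf_shift (x, \<xi>) f u = cis (2 * pi * (\<xi> \<bullet> u)) * f (u - x)"

definition gauss :: "'a::euclidean_space \<Rightarrow> complex"
  where "gauss u = complex_of_real (exp (- pi * (norm u)\<^sup>2))"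

end

theory Submission imports Defs "HOL-Probability.Characteristic_Functions" begin

text \<open>The proof rests on one geometric fact: for \<open>d = 1, 2, 3\<close> the projection of \<open>\<mu>\<^sub>t\<close> onto any line
  through the origin is half the Lebesgue measure on \<open>[-t, t]\<close>
  (\<open>distr_wave_measure_inner\<close>). On the line this is the definition, in the plane the
  integral of \<open>(a\<^sup>2 - v\<^sup>2) powr (- 1 / 2)\<close> over \<open>[-a, a]\<close> is \<open>pi\<close> for every \<open>a\<close>, and in space it is the
  hat-box theorem of Archimedes. An arbitrary direction is reduced to a fixed one by rotation
  invariance, which follows from the uniqueness of translation-invariant measures. Consequently the
  Fourier transform of \<open>\<mu>\<^sub>t\<close> is the integral of a character over \<open>[-t, t]\<close>, that is, the wave symbol
  (\<open>fourier_wave_measure\<close>). Since \<open>\<mu>\<^sub>t\<close> is finite and the Fourier transform of a shifted Gaussian is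
  integrable, Fubini's theorem and Fourier inversion turn the multiplier into convolution with \<open>\<mu>\<^sub>t\<close>
  at every point (\<open>wave_multiplier_eq_convolution\<close>).

  The inner product is then an average over \<open>p\<close>, distributed according to \<open>\<mu>\<^sub>t\<close>, of inner products of
  two shifted Gaussians, which are again Gaussians in \<open>p\<close> with a linear phase
  (\<open>inner_translated_tf_shifts\<close>). Its squared modulus is a double integral over \<open>\<mu>\<^sub>t \<Otimes> \<mu>\<^sub>t\<close>, and the
  parallelogram law separates the integrand in the coordinates \<open>u = (p + q) / 2\<close> and \<open>r = p - q\<close>. The
  direct computation produces \<open>x - y + u\<close>; the stated sign results from the substitution
  \<open>(p, q) \<mapsto> (-q, -p)\<close>, which reverses \<open>u\<close>, fixes \<open>r\<close>, and preserves \<open>\<mu>\<^sub>t \<Otimes> \<mu>\<^sub>t\<close> because \<open>\<mu>\<^sub>t\<close> is even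
  (\<open>cmod_square_integral_ambiguity_kernel\<close>). In dimension 3 this is the assertion; in dimensions 1 and
  2 the densities and a measure-preserving change of variables give the iterated integral
  (\<open>integral_wave_pair_measure_density\<close>).\<close>

section \<open>Lebesgue measure under linear isometries\<close>

lemma nn_integral_lborel_translate:
  fixes a :: "'a::euclidean_space"
  assumes [measurable]: "f \<in> borel_measurable borel"
  shows "(\<integral>\<^sup>+x. f (x + a) \<partial>lborel) = (\<integral>\<^sup>+x. f x \<partial>lborel)"
proof -
  have "(\<integral>\<^sup>+x. f x \<partial>lborel) = (\<integral>\<^sup>+x. f x \<partial>distr lborel borel (\<lambda>x. a + x))"
    by (simp add: lborel_distr_plus)
  also have "\<dots> = (\<integral>\<^sup>+x. f (x + a) \<partial>lborel)" by (subst nn_integral_distr) (auto simp: add.commute)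
  finally show ?thesis by simp
qed

text \<open>Uniqueness of the translation-invariant measure, with balls fixing the scale. Evaluating
  the product measure \<open>M \<Otimes> lborel\<close> on pairs \<open>(x, y)\<close> with \<open>x + y \<in> A\<close>, \<open>y\<close> in the unit ball \<open>B\<close>, once
  with the invariance of \<open>M\<close> and once with that of \<open>lborel\<close>, gives \<open>M A * lborel B = lborel A * M B\<close>.
  The symmetry of the ball absorbs the reflection that appears on the way.\<close>
lemma translation_invariant_eq_lborel:
  fixes M :: "'a::euclidean_space measure"
  assumes sets: "sets M = sets borel"
    and trans: "\<And>a. distr M borel (\<lambda>x. x + a) = M"
    and ball: "\<And>r. emeasure M (ball 0 r) = emeasure lborel (ball 0 r :: 'a set)"
  shows "M = lborel"
proof (rule measure_eqI)
  show "sets M = sets lborel" by (simp add: sets)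
  note [measurable_cong] = sets
  \<comment> \<open>The hypothesis on all balls, not only the unit ball, makes \<open>M\<close> sigma-finite.\<close>
  interpret M: sigma_finite_measure M
  proof (unfold sigma_finite_measure_def, intro exI[of _ "range (\<lambda>n::nat. ball 0 (real n))"] conjI)
    have "x \<in> (\<Union>n::nat. ball 0 (real n))" for x :: 'a
      using reals_Archimedean2[of "norm x"] by auto
    then show "\<Union> (range (\<lambda>n::nat. ball (0::'a) (real n))) = space M"
      using sets_eq_imp_space_eq[OF sets] by auto
  qed (use ball emeasure_lborel_ball_finite in \<open>auto simp: sets less_top\<close>)
  interpret P: pair_sigma_finite M lborel ..
  fix A assume "A \<in> sets M"
  then have A[measurable]: "A \<in> sets borel" by (simp add: sets)
  let ?B = "ball 0 1 :: 'a set"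
  have B[measurable]: "?B \<in> sets borel" by simp
  have shift: "(\<integral>\<^sup>+x. f (x + a) \<partial>M) = (\<integral>\<^sup>+x. f x \<partial>M)" if [measurable]: "f \<in> borel_measurable borel" for f a
  proof -
    have "(\<integral>\<^sup>+x. f x \<partial>M) = (\<integral>\<^sup>+x. f x \<partial>distr M borel (\<lambda>x. x + a))" by (simp add: trans)
    also have "\<dots> = (\<integral>\<^sup>+x. f (x + a) \<partial>M)" by (subst nn_integral_distr) auto
    finally show ?thesis by simp
  qed
  have "emeasure M A * emeasure lborel ?B
      = (\<integral>\<^sup>+y. (\<integral>\<^sup>+x. indicator A x \<partial>M) * indicator ?B y \<partial>lborel)"
    by (simp add: nn_integral_cmult sets)
  also have "\<dots> = (\<integral>\<^sup>+y. (\<integral>\<^sup>+x. indicator A (x + y) * indicator ?B y \<partial>M) \<partial>lborel)"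
    by (simp add: nn_integral_multc shift[of "indicator A"])
  also have "\<dots> = (\<integral>\<^sup>+x. (\<integral>\<^sup>+y. indicator A (x + y) * indicator ?B y \<partial>lborel) \<partial>M)"
    by (rule P.Fubini') measurable
  also have "\<dots> = (\<integral>\<^sup>+x. (\<integral>\<^sup>+y. indicator A y * indicator ?B (y - x) \<partial>lborel) \<partial>M)"
  proof (rule nn_integral_cong)
    fix x
    show "(\<integral>\<^sup>+y. indicator A (x + y) * indicator ?B y \<partial>lborel)
        = (\<integral>\<^sup>+y. indicator A y * indicator ?B (y - x) \<partial>lborel)"
      using nn_integral_lborel_translate[of "\<lambda>y. indicator A y * indicator ?B (y - x)" x] by (simp add: add.commute)
  qed
  also have "\<dots> = (\<integral>\<^sup>+y. (\<integral>\<^sup>+x. indicator A y * indicator ?B (y - x) \<partial>M) \<partial>lborel)"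
    by (rule P.Fubini'[symmetric]) measurable
  also have "\<dots> = (\<integral>\<^sup>+y. indicator A y * (\<integral>\<^sup>+x. indicator ?B (x - y) \<partial>M) \<partial>lborel)"
    by (auto simp: nn_integral_cmult indicator_def norm_minus_commute intro!: nn_integral_cong)
  also have "\<dots> = (\<integral>\<^sup>+y. indicator A y * emeasure M ?B \<partial>lborel)"
    using shift[of "indicator ?B" "- _"] by (simp add: sets)
  also have "\<dots> = emeasure lborel A * emeasure lborel ?B"
    by (simp add: nn_integral_multc ball)
  finally have *: "emeasure M A * emeasure lborel ?B = emeasure lborel A * emeasure lborel ?B" .
  have "0 < emeasure lborel ?B" "emeasure lborel ?B < top"
    using emeasure_lborel_ball_finite[of "0::'a" 1]
    by (auto simp: emeasure_ball)
  with * show "emeasure M A = emeasure lborel A"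
    by (metis ennreal_mult_divide_eq less_top not_gr_zero)
qed

text \<open>Source and target are different types here, so that computations on an arbitrary Euclidean
  space can be moved to a product of copies of the line. A linear isometry carries translations to
  translations and balls to balls, which is all that the uniqueness above asks for.\<close>
lemma distr_lborel_linear_isometry:
  fixes f :: "'a::euclidean_space \<Rightarrow> 'b::euclidean_space"
  assumes f: "linear f" "\<And>x. norm (f x) = norm x" and dim: "DIM('a) = DIM('b)"
  shows "distr lborel borel f = lborel"
proof (rule translation_invariant_eq_lborel)
  have [measurable]: "f \<in> borel_measurable borel"
    using f(1) by (intro borel_measurable_continuous_onI linear_continuous_on) (simp add: linear_linear)
  have "inj f" by (simp add: linear_injective_0[OF f(1)]) (metis f(2) norm_eq_zero)
  then have "dim (range f) = DIM('b)"
    using dim_image_eq[OF f(1), of UNIV] dim by (simp add: dim_UNIV)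
  then have "range f = UNIV"
    using dim_eq_full[of "range f"] linear_subspace_image[OF f(1) subspace_UNIV] by (metis span_eq_iff)
  show "distr (distr lborel borel f) borel (\<lambda>x. x + a) = distr lborel borel f" for a
  proof -
    obtain b where a: "a = f b" using \<open>range f = UNIV\<close> by (metis surjD)
    have "distr (distr lborel borel f) borel (\<lambda>x. x + a) = distr (distr lborel borel (\<lambda>x. b + x)) borel f"
      by (subst (1 2) distr_distr) (auto simp: o_def a linear_add[OF f(1)] add.commute)
    then show ?thesis by (simp add: lborel_distr_plus)
  qed
  show "emeasure (distr lborel borel f) (ball 0 r) = emeasure lborel (ball 0 r :: 'b set)" for r
  proof -
    have "f -` ball 0 r = ball 0 r" by (auto simp: f)
    moreover have "emeasure lborel (ball (0::'a) r) = emeasure lborel (ball (0::'b) r)"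
      by (cases "r \<ge> 0") (auto simp: emeasure_ball dim ball_empty)
    ultimately show ?thesis by (simp add: emeasure_distr)
  qed
qed simp

section \<open>Rotation invariance of the wave measure\<close>

lemma nn_integral_sphere_measure:
  fixes h :: "'a::euclidean_space \<Rightarrow> ennreal"
  assumes [measurable]: "h \<in> borel_measurable borel"
  shows "(\<integral>\<^sup>+y. h y \<partial>sphere_measure t) = ennreal (real DIM('a) / t) *
    (\<integral>\<^sup>+y. h ((t / norm y) *\<^sub>R y) * indicator (ball 0 t) y \<partial>lborel)"
proof -
  have [measurable]: "(\<lambda>y::'a. (t / norm y) *\<^sub>R y) \<in> borel_measurable (restrict_space lborel (ball 0 t))"
    by (rule measurable_restrict_space1) measurable
  show ?thesis unfolding sphere_measure_def
    by (subst nn_integral_scale_measure) (auto simp: nn_integral_distr nn_integral_restrict_space)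
qed

lemma sets_wave_measure[measurable_cong, simp]: "sets (wave_measure t) = sets borel"
  by (simp add: wave_measure_def sphere_measure_def)

lemma borel_measurable_wave_density[measurable]: "wave_density t \<in> borel_measurable borel"
proof -
  have [measurable]: "cball (0::'a) t \<in> sets borel" by simp
  show ?thesis
    unfolding wave_density_def[abs_def]
    by (cases "DIM('a) = 1"; cases "DIM('a) = 2"; simp) 
qed

lemma nn_integral_wave_measure:
  fixes h :: "'a::euclidean_space \<Rightarrow> ennreal"
  assumes [measurable]: "h \<in> borel_measurable borel"
  shows "(\<integral>\<^sup>+y. h y \<partial>wave_measure t) =
    (if DIM('a) = 3 then ennreal (1 / (4 * pi * t)) * (ennreal (3 / t) *
        (\<integral>\<^sup>+y. h ((t / norm y) *\<^sub>R y) * indicator (ball 0 t) y \<partial>lborel))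
     else (\<integral>\<^sup>+y. ennreal (wave_density t y) * h y \<partial>lborel))"
proof (cases "DIM('a) = 3")
  case True
  have [measurable]: "h \<in> borel_measurable (sphere_measure t)" by (simp add: sphere_measure_def)
  show ?thesis using True
    by (simp add: wave_measure_def nn_integral_scale_measure nn_integral_sphere_measure)
qed (simp add: wave_measure_def nn_integral_density)

text \<open>Rotation invariance of \<open>\<mu>\<^sub>t\<close>: the densities depend on \<open>norm y\<close> only, and the radial projection
  that defines the surface measure commutes with linear isometries. It yields both the reduction to
  a fixed direction and the evenness of \<open>\<mu>\<^sub>t\<close>.\<close>
lemma distr_wave_measure_linear_isometry:
  fixes f :: "'a::euclidean_space \<Rightarrow> 'b::euclidean_space"
  assumes f: "linear f" "\<And>x. norm (f x) = norm x" and dim: "DIM('a) = DIM('b)"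
  shows "distr (wave_measure t) borel f = wave_measure t"
proof (rule measure_eqI)
  have [measurable]: "f \<in> borel_measurable borel"
    using f(1) by (intro borel_measurable_continuous_onI linear_continuous_on) (simp add: linear_linear)
  fix A assume "A \<in> sets (distr (wave_measure t) borel f)"
  then have [measurable]: "A \<in> sets borel" by simp
  have L: "(\<integral>\<^sup>+x. h (f x) \<partial>lborel) = (\<integral>\<^sup>+y. h y \<partial>lborel)" if [measurable]: "h \<in> borel_measurable borel" for h
    by (subst distr_lborel_linear_isometry[OF assms, symmetric]) (simp add: nn_integral_distr)
  have "(\<integral>\<^sup>+x. h (f x) \<partial>wave_measure t) = (\<integral>\<^sup>+y. h y \<partial>wave_measure t)"
    if [measurable]: "h \<in> borel_measurable borel" for h
  proof -
    have "wave_density t (f x) = wave_density t x" for x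
      by (simp add: wave_density_def dim f indicator_def)
    moreover have "indicator (ball 0 t) (f x) = (indicator (ball 0 t) x :: ennreal)" for x
      by (simp add: f indicator_def)
    moreover have [measurable]: "ball (0::'b) t \<in> sets borel" by simp
    ultimately show ?thesis
      using L[of "\<lambda>y. h ((t / norm y) *\<^sub>R y) * indicator (ball 0 t) y"]
        L[of "\<lambda>y. ennreal (wave_density t y) * h y"]
      by (simp add: nn_integral_wave_measure dim f linear_scale[OF f(1)])
  qed
  from this[of "indicator A"]
  show "emeasure (distr (wave_measure t) borel f) A = emeasure (wave_measure t) A"
    by (simp add: nn_integral_distr flip: nn_integral_indicator)
qed simp

section \<open>Projections of balls and discs\<close>

text \<open>The primitive of the integrand is \<open>arcsin (v / a)\<close>; the value does not depend on the radius
  \<open>a\<close>. This is why the planar density projects to a constant on a line.\<close>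
lemma nn_integral_semicircle_reciprocal:
  assumes a: "0 < (a::real)"
  shows "(\<integral>\<^sup>+v. ennreal (max 0 (a\<^sup>2 - v\<^sup>2) powr (- 1 / 2)) \<partial>lborel) = ennreal pi"
proof -
  let ?f = "\<lambda>v. (a\<^sup>2 - v\<^sup>2) powr (- 1 / 2)"
  let ?F = "\<lambda>v. arcsin (v / a)"
  have pos: "0 < a\<^sup>2 - v\<^sup>2" if "-a < v" "v < a" for v
    using power_strict_mono[of "\<bar>v\<bar>" a 2] that by simp
  have cont: "continuous_on {-a..a} ?F"
    using a by (intro continuous_intros) (auto simp: field_simps)
  have der: "DERIV ?F v :> ?f v" if "-a < v" "v < a" for v
  proof -
    have "a * sqrt (1 - (v / a)\<^sup>2) = sqrt (a\<^sup>2 - v\<^sup>2)"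
    proof -
      have "1 - (v / a)\<^sup>2 = (a\<^sup>2 - v\<^sup>2) / a\<^sup>2" using a by (simp add: field_simps)
      then show ?thesis using a by (simp add: real_sqrt_divide)
    qed
    moreover have "?f v = 1 / sqrt (a\<^sup>2 - v\<^sup>2)"
      using pos[OF that] by (simp add: powr_minus powr_half_sqrt field_simps)
    ultimately show ?thesis using that a
      by (auto intro!: derivative_eq_intros simp: field_simps)
  qed
  have FTC: "set_integrable lborel (einterval (ereal (-a)) (ereal a)) ?f"
      "(LBINT x=ereal (-a)..ereal a. ?f x) = pi"
  proof -
    have *: "((?F \<circ> real_of_ereal) \<longlongrightarrow> - (pi / 2)) (at_right (ereal (- a)))"
      "((?F \<circ> real_of_ereal) \<longlongrightarrow> pi / 2) (at_left (ereal a))"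
      using continuous_on_Icc_at_rightD[OF cont] continuous_on_Icc_at_leftD[OF cont] a
      by (simp_all only: ereal_tendsto_simps1, simp_all)
    have c: "isCont ?f x" if "ereal (-a) < ereal x" "ereal x < ereal a" for x
      using pos[of x] that by (intro continuous_intros) auto
    note R = interval_integral_FTC_nonneg[OF _ _ c _ *]
    show "set_integrable lborel (einterval (ereal (-a)) (ereal a)) ?f"
      by (rule R(1)) (use a der in auto)
    have "(LBINT x=ereal (-a)..ereal a. ?f x) = pi / 2 - - (pi / 2)"
      by (rule R(2)) (use a der in auto)
    then show "(LBINT x=ereal (-a)..ereal a. ?f x) = pi" by simp
  qed
  have "(\<integral>\<^sup>+v. ennreal (max 0 (a\<^sup>2 - v\<^sup>2) powr (- 1 / 2)) \<partial>lborel)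
      = (\<integral>\<^sup>+v. ennreal (indicator {-a<..<a} v *\<^sub>R ?f v) \<partial>lborel)"
  proof (rule nn_integral_cong)
    fix v
    show "ennreal (max 0 (a\<^sup>2 - v\<^sup>2) powr (- 1 / 2)) = ennreal (indicator {-a<..<a} v *\<^sub>R ?f v)"
    proof (cases "-a < v \<and> v < a")
      case True
      then show ?thesis using pos[of v] by (simp add: max_def)
    next
      case False
      then have "\<bar>a\<bar> \<le> \<bar>v\<bar>" using a by auto
      then have "a\<^sup>2 \<le> v\<^sup>2" by (simp only: abs_le_square_iff)
      with False show ?thesis by (auto simp: max_def)
    qed
  qed
  also have "\<dots> = ennreal (\<integral>v. indicator {-a<..<a} v *\<^sub>R ?f v \<partial>lborel)"
    using FTC(1) by (intro nn_integral_eq_integral) (auto simp: set_integrable_def)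
  also have "(\<integral>v. indicator {-a<..<a} v *\<^sub>R ?f v \<partial>lborel) = pi"
    using FTC(2) a by (simp add: interval_lebesgue_integral_def set_lebesgue_integral_def)
  finally show ?thesis .
qed

text \<open>In the plane the disc of squared radius \<open>a\<close> has area \<open>pi * a\<close>, which is linear in \<open>a\<close>; hence
  the squared norm is uniformly distributed on the half-line.\<close>
lemma distr_lborel_square_norm_plane:
  "distr (lborel :: (real \<times> real) measure) borel (\<lambda>z. (norm z)\<^sup>2)
    = density lborel (\<lambda>v. ennreal pi * indicator {0..} v)" (is "?D = ?R")
proof -
  have disc: "emeasure ?D {..<a} = ennreal (pi * max 0 a)" for a
  proof (cases "a > 0")
    case True
    have "(norm z)\<^sup>2 < a \<longleftrightarrow> norm z < sqrt a" for z :: "real \<times> real"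
      using real_sqrt_less_iff[of "(norm z)\<^sup>2" a] by simp
    then have "(\<lambda>z :: real \<times> real. (norm z)\<^sup>2) -` {..<a} = ball 0 (sqrt a)"
      by auto
    then show ?thesis using True by (simp add: emeasure_distr emeasure_ball unit_ball_vol_2)
  next
    case False
    then have "(\<lambda>z :: real \<times> real. (norm z)\<^sup>2) -` {..<a} = {}"
      by (auto simp: not_less simp del: norm_Pair) (meson dual_order.trans leD zero_le_power2)
    with False show ?thesis by (simp add: emeasure_distr)
  qed
  have half: "emeasure ?R {..<a} = ennreal (pi * max 0 a)" for a
  proof -
    have "(\<integral>\<^sup>+v. ennreal pi * indicator {0..} v * indicator {..<a} v \<partial>lborel)
        = (\<integral>\<^sup>+v. ennreal pi * indicator {0..<a} v \<partial>lborel)"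
      by (intro nn_integral_cong) (auto simp: indicator_def)
    also have "\<dots> = ennreal (pi * max 0 a)"
      by (cases "a \<ge> 0") (auto simp: nn_integral_cmult ennreal_mult)
    finally show ?thesis by (simp add: emeasure_density)
  qed
  show ?thesis
  proof (rule measure_eqI_generator_eq[where E = "range lessThan" and \<Omega> = UNIV
        and A = "\<lambda>n. {..<real n}"])
    have "{..<a} \<inter> {..<b} = {..<min a b}" for a b :: real by auto
    then show "Int_stable (range lessThan :: real set set)"
      by (auto simp: Int_stable_def)
    show "(\<Union>n. {..<real n}) = UNIV" using reals_Archimedean2 by auto
  qed (use disc half in \<open>auto simp: borel_Iio\<close>)
qed

lemma nn_integral_square_norm_plane:
  assumes [measurable]: "k \<in> borel_measurable borel"
  shows "(\<integral>\<^sup>+z. k ((norm z)\<^sup>2) \<partial>(lborel :: (real \<times> real) measure))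
    = ennreal pi * (\<integral>\<^sup>+v. indicator {0..} v * k v \<partial>lborel)"
proof -
  have "(\<integral>\<^sup>+z. k ((norm z)\<^sup>2) \<partial>(lborel :: (real \<times> real) measure))
      = (\<integral>\<^sup>+v. k v \<partial>distr (lborel :: (real \<times> real) measure) borel (\<lambda>z. (norm z)\<^sup>2))"
    by (subst nn_integral_distr) auto
  then show ?thesis
    by (simp add: distr_lborel_square_norm_plane nn_integral_density mult.assoc nn_integral_cmult)
qed

lemma nn_integral_lborel_pair:
  fixes f :: "'a::euclidean_space \<times> 'b::euclidean_space \<Rightarrow> ennreal"
  assumes "f \<in> borel_measurable borel"
  shows "(\<integral>\<^sup>+y. f y \<partial>lborel) = (\<integral>\<^sup>+s. (\<integral>\<^sup>+z. f (s, z) \<partial>lborel) \<partial>lborel)"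
  using lborel.nn_integral_fst[of f lborel] assms by (simp add: lborel_prod)

text \<open>The hat-box theorem of Archimedes in integrated form: the first coordinate of the radial
  projection of a ball is uniform on \<open>[-t, t]\<close>. Write \<open>y = (s, z)\<close> with \<open>z\<close> in the plane. The squared
  norm of \<open>z\<close> is uniform, so \<open>w = s\<^sup>2 + (norm z)\<^sup>2\<close> can replace it as a variable; for fixed \<open>w\<close> the
  coordinate \<open>s\<close> then runs over \<open>[-sqrt w, sqrt w]\<close> and is rescaled to \<open>[-t, t]\<close>. The remaining factor
  \<open>K\<close> does not depend on \<open>h\<close>; the choice \<open>h = 1\<close> and the volume of the ball determine it.\<close>
lemma nn_integral_ball_cosine:
  fixes t :: real
  assumes t: "t > 0" and [measurable]: "h \<in> borel_measurable borel"
  shows "(\<integral>\<^sup>+y. h (t / norm y * fst y) * indicator (ball 0 t) y \<partial>(lborel :: (real \<times> real \<times> real) measure))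
    = ennreal (2 / 3 * pi * t\<^sup>2) * (\<integral>\<^sup>+s. h s * indicator {-t..t} s \<partial>lborel)"
proof -
  define K where "K = ennreal pi * (\<integral>\<^sup>+w. indicator {0<..<t\<^sup>2} w * ennreal (sqrt w / t) \<partial>lborel)"
  let ?I = "\<lambda>h::real \<Rightarrow> ennreal. \<integral>\<^sup>+y. h (t / norm y * fst y) * indicator (ball 0 t) y
      \<partial>(lborel :: (real \<times> real \<times> real) measure)"
  have I: "?I h = K * (\<integral>\<^sup>+s. h s * indicator {-t..t} s \<partial>lborel)"
    if [measurable]: "h \<in> borel_measurable borel" for h
  proof -
    define g where "g s w = h (t / sqrt w * s) * indicator {..<t\<^sup>2} w" for s w
    have g1: "case_prod g \<in> borel_measurable (borel \<Otimes>\<^sub>M borel)"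
      unfolding g_def by measurable
    have [measurable]: "case_prod g \<in> borel_measurable borel"
      "case_prod g \<in> borel_measurable (lborel \<Otimes>\<^sub>M lborel)"
      using g1 by (simp_all add: borel_prod lborel_prod)
    have G: "(\<lambda>(s, w). indicator {s\<^sup>2..} w * g s w) \<in> borel_measurable (lborel \<Otimes>\<^sub>M lborel)"
    proof -
      have "(\<lambda>(s, w). indicator {s\<^sup>2..} w * g s w)
          = (\<lambda>p. if (fst p)\<^sup>2 \<le> snd p then case_prod g p else 0)"
        by (auto simp: fun_eq_iff indicator_def)
      also have "\<dots> \<in> borel_measurable (lborel \<Otimes>\<^sub>M lborel)" by measurable
      finally show ?thesis .
    qed
    have "?I h = (\<integral>\<^sup>+y. g (fst y) ((fst y)\<^sup>2 + (norm (snd y))\<^sup>2) \<partial>(lborel :: (real \<times> real \<times> real) measure))"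
    proof (intro nn_integral_cong)
      fix y :: "real \<times> real \<times> real"
      have n: "norm y = sqrt ((fst y)\<^sup>2 + (norm (snd y))\<^sup>2)" by (simp add: norm_prod_def)
      have "norm y < t \<longleftrightarrow> (norm y)\<^sup>2 < t\<^sup>2"
        using t power_mono_iff[of t "norm y" 2] by (simp del: power_mono_iff flip: not_le)
      then show "h (t / norm y * fst y) * indicator (ball 0 t) y = g (fst y) ((fst y)\<^sup>2 + (norm (snd y))\<^sup>2)"
        by (simp add: g_def n indicator_def)
    qed
    also have "\<dots> = (\<integral>\<^sup>+s. (\<integral>\<^sup>+z. g s (s\<^sup>2 + (norm z)\<^sup>2) \<partial>(lborel :: (real \<times> real) measure)) \<partial>lborel)"
    proof (subst nn_integral_lborel_pair)
      have "(\<lambda>y. case_prod g (fst y, (fst y)\<^sup>2 + (norm (snd y))\<^sup>2))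
          \<in> borel_measurable (borel :: (real \<times> real \<times> real) measure)"
        by (rule measurable_compose[OF borel_measurable_continuous_onI])
          (intro continuous_intros, simp)
      then show "(\<lambda>y. g (fst y) ((fst y)\<^sup>2 + (norm (snd y))\<^sup>2))
          \<in> borel_measurable (borel :: (real \<times> real \<times> real) measure)" by simp
    qed simp
    also have "\<dots> = (\<integral>\<^sup>+s. ennreal pi * (\<integral>\<^sup>+v. indicator {0..} v * g s (s\<^sup>2 + v) \<partial>lborel) \<partial>lborel)"
      by (intro nn_integral_cong nn_integral_square_norm_plane) measurable
    also have "\<dots> = (\<integral>\<^sup>+s. ennreal pi * (\<integral>\<^sup>+w. indicator {s\<^sup>2..} w * g s w \<partial>lborel) \<partial>lborel)"
    proof (rule nn_integral_cong)
      fix s :: real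
      have "indicator {0..} v = (indicator {s\<^sup>2..} (s\<^sup>2 + v) :: ennreal)" for v :: real
        by (auto simp: indicator_def)
      then have "(\<integral>\<^sup>+v. indicator {0..} v * g s (s\<^sup>2 + v) \<partial>lborel) = (\<integral>\<^sup>+w. indicator {s\<^sup>2..} w * g s w \<partial>lborel)"
        by (subst nn_integral_real_affine[where c=1 and t="s\<^sup>2"]) simp_all
      then show "ennreal pi * (\<integral>\<^sup>+v. indicator {0..} v * g s (s\<^sup>2 + v) \<partial>lborel)
          = ennreal pi * (\<integral>\<^sup>+w. indicator {s\<^sup>2..} w * g s w \<partial>lborel)" by simp
    qed
    also have "\<dots> = ennreal pi * (\<integral>\<^sup>+s. (\<integral>\<^sup>+w. indicator {s\<^sup>2..} w * g s w \<partial>lborel) \<partial>lborel)"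
      using lborel.borel_measurable_nn_integral[OF G] by (intro nn_integral_cmult) simp
    also have "\<dots> = ennreal pi * (\<integral>\<^sup>+w. (\<integral>\<^sup>+s. indicator {s\<^sup>2..} w * g s w \<partial>lborel) \<partial>lborel)"
      using G by (subst lborel_pair.Fubini') simp_all
    also have "(\<integral>\<^sup>+w. (\<integral>\<^sup>+s. indicator {s\<^sup>2..} w * g s w \<partial>lborel) \<partial>lborel)
       = (\<integral>\<^sup>+w. indicator {0<..<t\<^sup>2} w * ennreal (sqrt w / t) * (\<integral>\<^sup>+s. h s * indicator {-t..t} s \<partial>lborel) \<partial>lborel)"
    proof (rule nn_integral_cong_AE, use AE_lborel_singleton[of "0::real"] in eventually_elim)
      \<comment> \<open>At \<open>w = 0\<close> the rescaling of \<open>s\<close> would be degenerate.\<close>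
    fix w :: real assume "w \<noteq> 0"
      show "(\<integral>\<^sup>+s. indicator {s\<^sup>2..} w * g s w \<partial>lborel)
        = indicator {0<..<t\<^sup>2} w * ennreal (sqrt w / t) * (\<integral>\<^sup>+s. h s * indicator {-t..t} s \<partial>lborel)"
      proof (cases "0 < w \<and> w < t\<^sup>2")
        case True
        then have c: "sqrt w / t > 0" using t by simp
        have "indicator {(sqrt w / t * s)\<^sup>2..} w = (indicator {-t..t} s :: ennreal)" for s
        proof -
          have "(sqrt w / t * s)\<^sup>2 \<le> w \<longleftrightarrow> s\<^sup>2 \<le> t\<^sup>2"
            using True t by (simp add: power_mult_distrib power_divide field_simps)
          also have "\<dots> \<longleftrightarrow> -t \<le> s \<and> s \<le> t"
            using abs_le_square_iff[of s t] t by (simp add: abs_le_iff) linarith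
          finally show ?thesis by (auto simp: indicator_def)
        qed
        moreover have "t / sqrt w * (sqrt w / t * s) = s" for s using True t by simp
        moreover have [measurable]: "(\<lambda>s. indicator {s\<^sup>2..} w :: ennreal) \<in> borel_measurable borel"
        proof -
          have "(\<lambda>s. indicator {s\<^sup>2..} w :: ennreal) = (\<lambda>s. if s\<^sup>2 \<le> w then 1 else 0)"
            by (auto simp: indicator_def)
          then show ?thesis by simp
        qed
        ultimately have "(\<integral>\<^sup>+s. indicator {s\<^sup>2..} w * g s w \<partial>lborel)
           = ennreal (sqrt w / t) * (\<integral>\<^sup>+s. h s * indicator {-t..t} s \<partial>lborel)"
          using True c t unfolding g_def
          by (subst nn_integral_real_affine[where c="sqrt w / t" and t=0]) (simp_all add: mult.commute)
        then show ?thesis using True by simp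
      next
        case False
        have z: "indicator {s\<^sup>2..} w * g s w = 0" for s
        proof (cases "w < 0")
          case True
          then have "w < s\<^sup>2" by (meson less_le_trans zero_le_power2)
          then show ?thesis by simp
        next
          case f: False
          with False \<open>w \<noteq> 0\<close> show ?thesis by (simp add: g_def indicator_def)
        qed
        have "(\<integral>\<^sup>+s. indicator {s\<^sup>2..} w * g s w \<partial>lborel) = 0"
          by (simp only: z) simp
        with False show ?thesis by simp
      qed
    qed
    also have "\<dots> = (\<integral>\<^sup>+w. indicator {0<..<t\<^sup>2} w * ennreal (sqrt w / t) \<partial>lborel)
        * (\<integral>\<^sup>+s. h s * indicator {-t..t} s \<partial>lborel)"
      by (rule nn_integral_multc) measurable
    finally show ?thesis by (simp add: K_def mult.assoc)
  qed
  have "emeasure (lborel :: (real \<times> real \<times> real) measure) (ball 0 t) = K * ennreal (2 * t)"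
    using I[of "\<lambda>_. 1"] t by simp
  moreover have "emeasure (lborel :: (real \<times> real \<times> real) measure) (ball 0 t) = ennreal (4 / 3 * pi * t ^ 3)"
    using t by (simp add: emeasure_ball unit_ball_vol_3 power3_eq_cube)
  ultimately have "K * ennreal (2 * t) / ennreal (2 * t) = ennreal (4 / 3 * pi * t ^ 3) / ennreal (2 * t)"
    by simp
  then have "K = ennreal (4 / 3 * pi * t ^ 3) / ennreal (2 * t)"
    using t by (subst (asm) ennreal_mult_divide_eq) auto
  also have "\<dots> = ennreal (2 / 3 * pi * t\<^sup>2)"
  proof -
    have "t ^ 3 = t * t\<^sup>2" by (simp add: power3_eq_cube power2_eq_square)
    then show ?thesis using t by (subst divide_ennreal) auto
  qed
  finally have "K = ennreal (2 / 3 * pi * t\<^sup>2)" .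
  then show ?thesis by (simp only: I[OF assms(2)])
qed

section \<open>Projection of the wave measure onto a line\<close>

lemma nn_integral_wave_measure_line:
  fixes t :: real
  assumes t: "t > 0" and [measurable]: "h \<in> borel_measurable borel"
  shows "(\<integral>\<^sup>+y. h (y \<bullet> (1 :: real)) \<partial>wave_measure t)
    = ennreal (1 / 2) * (\<integral>\<^sup>+s. h s * indicator {-t..t} s \<partial>lborel)"
proof -
  have "(\<integral>\<^sup>+y. h (y \<bullet> (1 :: real)) \<partial>wave_measure t)
      = (\<integral>\<^sup>+s. ennreal (1 / 2) * (h s * indicator {-t..t} s) \<partial>lborel)"
    by (subst nn_integral_wave_measure)
      (auto simp: wave_density_def indicator_def mult.commute intro!: nn_integral_cong)
  then show ?thesis by (simp add: nn_integral_cmult)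
qed

lemma nn_integral_wave_measure_plane:
  fixes t :: real
  assumes t: "t > 0" and [measurable]: "h \<in> borel_measurable borel"
  shows "(\<integral>\<^sup>+y. h (y \<bullet> (1 :: real, 0 :: real)) \<partial>wave_measure t)
    = ennreal (1 / 2) * (\<integral>\<^sup>+s. h s * indicator {-t..t} s \<partial>lborel)"
proof -
  have [measurable]: "(\<lambda>y. h (fst y)) \<in> borel_measurable (borel :: (real \<times> real) measure)"
    by (rule measurable_compose[OF borel_measurable_continuous_onI]) (auto intro!: continuous_intros)
  have "(\<integral>\<^sup>+y. h (y \<bullet> (1 :: real, 0 :: real)) \<partial>wave_measure t)
      = (\<integral>\<^sup>+y. ennreal (wave_density t y) * h (fst y) \<partial>(lborel :: (real \<times> real) measure))"
    by (subst nn_integral_wave_measure) (auto simp: inner_prod_def)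
  also have "\<dots> = (\<integral>\<^sup>+s. (\<integral>\<^sup>+v. ennreal (wave_density t (s, v :: real)) * h s \<partial>lborel) \<partial>lborel)"
    by (subst nn_integral_lborel_pair) auto
  also have "\<dots> = (\<integral>\<^sup>+s. ennreal (1 / 2) * (h s * indicator {-t..t} s) \<partial>lborel)"
  proof (rule nn_integral_cong_AE, use AE_lborel_singleton[of t] AE_lborel_singleton[of "-t"] in eventually_elim)
    \<comment> \<open>For \<open>s = t\<close> and \<open>s = - t\<close> the inner integral is 0, but the interval on the right is closed.\<close>
    fix s :: real assume s: "s \<noteq> t" "s \<noteq> -t"
    have d: "wave_density t (s, v) = max 0 ((t\<^sup>2 - s\<^sup>2) - v\<^sup>2) powr (- 1 / 2) / (2 * pi)" for v :: real
      by (simp add: wave_density_def norm_prod_def algebra_simps)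
    show "(\<integral>\<^sup>+v. ennreal (wave_density t (s, v :: real)) * h s \<partial>lborel)
      = ennreal (1 / 2) * (h s * indicator {-t..t} s)"
    proof (cases "\<bar>s\<bar> < t")
      case True
      then have pos: "0 < t\<^sup>2 - s\<^sup>2"
        using power_strict_mono[of "\<bar>s\<bar>" t 2] by simp
      have [measurable]: "(\<lambda>v. wave_density t (s, v)) \<in> borel_measurable borel"
        unfolding d by measurable
      have "(\<integral>\<^sup>+v. ennreal (wave_density t (s, v :: real)) * h s \<partial>lborel)
         = (\<integral>\<^sup>+v. ennreal (1 / (2 * pi)) * ennreal (max 0 ((sqrt (t\<^sup>2 - s\<^sup>2))\<^sup>2 - v\<^sup>2) powr (- 1 / 2)) \<partial>lborel) * h s"
        using pos by (simp add: nn_integral_multc d flip: ennreal_mult')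
      also have "\<dots> = ennreal (1 / (2 * pi)) * ennreal pi * h s"
        using nn_integral_semicircle_reciprocal[of "sqrt (t\<^sup>2 - s\<^sup>2)"] pos
        by (subst nn_integral_cmult) auto
      also have "ennreal (1 / (2 * pi)) * ennreal pi = ennreal (1 / 2)"
        by (simp flip: ennreal_mult')
      finally show ?thesis using True by (simp add: indicator_def abs_less_iff)
    next
      case False
      then have "t\<^sup>2 \<le> s\<^sup>2" using t abs_le_square_iff[of t s] by auto
      then have "wave_density t (s, v) = 0" for v :: real
        unfolding d by (simp add: max_def) (smt (verit) zero_le_power2)
      with False s t show ?thesis by (auto simp: indicator_def)
    qed
  qed
  finally show ?thesis by (simp add: nn_integral_cmult)
qed

lemma nn_integral_wave_measure_space:
  fixes t :: real
  assumes t: "t > 0" and [measurable]: "h \<in> borel_measurable borel"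
  shows "(\<integral>\<^sup>+y. h (y \<bullet> (1 :: real, 0 :: real, 0 :: real)) \<partial>wave_measure t)
    = ennreal (1 / 2) * (\<integral>\<^sup>+s. h s * indicator {-t..t} s \<partial>lborel)"
proof -
  have "ennreal (1 / (4 * pi * t)) * (ennreal (3 / t) * (ennreal (2 / 3 * pi * t\<^sup>2) * X)) = ennreal (1 / 2) * X" for X
  proof -
    have "1 / (4 * pi * t) * (3 / t) * (2 / 3 * pi * t\<^sup>2) = 1 / 2"
      using t by (simp add: field_simps power2_eq_square)
    moreover have "ennreal (1 / (4 * pi * t)) * (ennreal (3 / t) * (ennreal (2 / 3 * pi * t\<^sup>2) * X))
        = ennreal (1 / (4 * pi * t) * (3 / t) * (2 / 3 * pi * t\<^sup>2)) * X"
    proof -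
      have "ennreal a * (ennreal b * (ennreal c * X)) = ennreal (a * b * c) * X"
        if "0 \<le> a" "0 \<le> b" "0 \<le> c" for a b c
        using that by (simp add: ennreal_mult mult.assoc)
      from this[of "1 / (4 * pi * t)" "3 / t" "2 / 3 * pi * t\<^sup>2"] show ?thesis
        using t by simp
    qed
    ultimately show ?thesis by (simp only:)
  qed
  moreover have "(\<lambda>y. h (fst y)) \<in> borel_measurable (borel :: (real \<times> real \<times> real) measure)"
    by (rule measurable_compose[OF borel_measurable_continuous_onI]) (auto intro!: continuous_intros)
  ultimately show ?thesis
    using nn_integral_ball_cosine[OF assms]
    by (subst nn_integral_wave_measure) (auto simp: inner_prod_def)
qed

lemma linear_isometry_inner:
  fixes f :: "'a::real_inner \<Rightarrow> 'b::real_inner"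
  assumes "linear f" "\<And>x. norm (f x) = norm x"
  shows "f x \<bullet> f y = x \<bullet> y"
  by (simp add: dot_norm assms(2) flip: linear_add[OF assms(1)])

text \<open>An arbitrary isometry of the two spaces, preceded by a rotation that corrects the image
  of \<open>e\<close>.\<close>
lemma linear_isometry_to_direction:
  fixes e :: "real ^ 'n" and e' :: "'b::euclidean_space"
  assumes "norm e = 1" "norm e' = 1" "CARD('n) = DIM('b)"
  obtains f :: "real ^ 'n \<Rightarrow> 'b" where "linear f" "\<And>x. norm (f x) = norm x" "f e = e'"
proof -
  obtain g :: "real ^ 'n \<Rightarrow> 'b" and k where g: "linear g" "\<And>x. norm (g x) = norm x"
    and k: "\<And>y. norm (k y) = norm y" "\<And>y. g (k y) = y"
    using isomorphisms_UNIV_UNIV[where 'M = "real ^ 'n" and 'N = 'b] assms(3) by (metis DIM_cart DIM_real mult.right_neutral)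
  obtain T where T: "orthogonal_transformation T" "T e = k e'"
    using orthogonal_transformation_exists_1[of e "k e'"] assms k by auto
  show ?thesis
  proof (rule that)
    show "linear (g \<circ> T)" using g(1) T(1) by (intro linear_compose) (auto simp: orthogonal_transformation_def)
    show "norm ((g \<circ> T) x) = norm x" for x using g T by (simp add: orthogonal_transformation_norm)
    show "(g \<circ> T) e = e'" using T k by simp
  qed
qed

text \<open>Carries the computation of the projection of \<open>\<mu>\<^sub>t\<close> onto an arbitrary direction to a fixed
  direction in a concrete space of the same dimension.\<close>
lemma nn_integral_wave_measure_inner_transfer:
  fixes e :: "real ^ 'n" and e' :: "'b::euclidean_space"
  assumes "norm e = 1" "norm e' = 1" "CARD('n) = DIM('b)" and [measurable]: "h \<in> borel_measurable borel"
  shows "(\<integral>\<^sup>+y. h (y \<bullet> e) \<partial>wave_measure t) = (\<integral>\<^sup>+y. h (y \<bullet> e') \<partial>wave_measure t)"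
proof -
  obtain f :: "real ^ 'n \<Rightarrow> 'b" where f: "linear f" "\<And>x. norm (f x) = norm x" "f e = e'"
    using linear_isometry_to_direction assms by blast
  have [measurable]: "f \<in> borel_measurable borel"
    using f(1) by (intro borel_measurable_continuous_onI linear_continuous_on) (simp add: linear_linear)
  have "(\<integral>\<^sup>+y. h (y \<bullet> e') \<partial>wave_measure t) = (\<integral>\<^sup>+y. h (y \<bullet> e') \<partial>distr (wave_measure t) borel f)"
    using distr_wave_measure_linear_isometry[OF f(1,2)] assms(3) by simp
  also have "\<dots> = (\<integral>\<^sup>+y. h (f y \<bullet> e') \<partial>wave_measure t)"
    by (subst nn_integral_distr) auto
  finally show ?thesis by (simp add: linear_isometry_inner[OF f(1,2)] flip: f(3))
qed

lemma nn_integral_wave_measure_inner: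
  fixes e :: "real ^ 'n"
  assumes n: "CARD('n) \<in> {1, 2, 3}" and t: "t > 0" and e: "norm e = 1" and h: "h \<in> borel_measurable borel"
  shows "(\<integral>\<^sup>+y. h (y \<bullet> e) \<partial>wave_measure t) = ennreal (1 / 2) * (\<integral>\<^sup>+s. h s * indicator {-t..t} s \<partial>lborel)"
  using n
proof (elim insertE)
  assume "CARD('n) = 1"
  then show ?thesis
    using nn_integral_wave_measure_inner_transfer[OF e _ _ h, of "1::real"] nn_integral_wave_measure_line[OF t h] by simp
next
  assume "CARD('n) = 2"
  then show ?thesis
    using nn_integral_wave_measure_inner_transfer[OF e _ _ h, of "(1::real, 0::real)"]
      nn_integral_wave_measure_plane[OF t h] by (simp add: norm_prod_def)
next
  assume "CARD('n) = 3"
  then show ?thesis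
    using nn_integral_wave_measure_inner_transfer[OF e _ _ h, of "(1::real, 0::real, 0::real)"]
      nn_integral_wave_measure_space[OF t h] by (simp add: norm_prod_def)
qed simp

text \<open>The geometric core. In all three dimensions the projection of \<open>\<mu>\<^sub>t\<close> onto a line is half the
  Lebesgue measure on \<open>[-t, t]\<close>, and therefore the Fourier transform of \<open>\<mu>\<^sub>t\<close> has the same formula.\<close>
lemma distr_wave_measure_inner:
  fixes e :: "real ^ 'n"
  assumes n: "CARD('n) \<in> {1, 2, 3}" and t: "t > 0" and e: "norm e = 1"
  shows "distr (wave_measure t) borel (\<lambda>y. y \<bullet> e) = density lborel (\<lambda>s. ennreal (indicator {-t..t} s / 2))"
proof (rule measure_eqI)
  fix A assume "A \<in> sets (distr (wave_measure t) borel (\<lambda>y. y \<bullet> e))"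
  then have [measurable]: "A \<in> sets borel" by simp
  have "emeasure (distr (wave_measure t) borel (\<lambda>y. y \<bullet> e)) A = (\<integral>\<^sup>+y. indicator A (y \<bullet> e) \<partial>wave_measure t)"
    by (simp add: nn_integral_distr flip: nn_integral_indicator)
  also have "\<dots> = ennreal (1 / 2) * (\<integral>\<^sup>+s. indicator A s * indicator {-t..t} s \<partial>lborel)"
    by (rule nn_integral_wave_measure_inner[OF assms]) simp
  also have "\<dots> = (\<integral>\<^sup>+s. ennreal (indicator {-t..t} s / 2) * indicator A s \<partial>lborel)"
    by (subst nn_integral_cmult[symmetric]) (auto intro!: nn_integral_cong simp: indicator_def)
  finally show "emeasure (distr (wave_measure t) borel (\<lambda>y. y \<bullet> e)) A
      = emeasure (density lborel (\<lambda>s. ennreal (indicator {-t..t} s / 2))) A"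
    by (simp add: emeasure_density)
qed simp

section \<open>The Fourier transform of the wave measure\<close>

lemma emeasure_wave_measure_UNIV:
  assumes "CARD('n) \<in> {1, 2, 3}" and "t > 0"
  shows "emeasure (wave_measure t :: (real ^ 'n) measure) UNIV = ennreal t"
proof -
  obtain e :: "real ^ 'n" where e: "norm e = 1" using vector_choose_size zero_le_one by blast
  have "emeasure (wave_measure t :: (real ^ 'n) measure) UNIV = ennreal (1 / 2) * ennreal (2 * t)"
    using nn_integral_wave_measure_inner[OF assms e, of "\<lambda>_. 1"] assms(2)
    by (simp add: sets_eq_imp_space_eq[OF sets_wave_measure])
  also have "\<dots> = ennreal (1 / 2 * (2 * t))" by (rule ennreal_mult'[symmetric]) simp
  also have "\<dots> = ennreal t" by simp
  finally show ?thesis .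
qed

lemma finite_wave_measure:
  assumes "CARD('n) \<in> {1, 2, 3}" and "t > 0"
  shows "finite_measure (wave_measure t :: (real ^ 'n) measure)"
  using emeasure_wave_measure_UNIV[OF assms]
  by (intro finite_measureI) (simp add: sets_eq_imp_space_eq[OF sets_wave_measure])

lemma borel_measurable_cis[measurable]: "cis \<in> borel_measurable borel"
  by (intro borel_measurable_continuous_onI continuous_intros)

lemma integral_cis_interval:
  assumes a: "a \<noteq> 0" and t: "t > 0"
  shows "(\<integral>s. indicator {-t..t} s *\<^sub>R cis (- (a * s)) \<partial>lborel) = 2 * complex_of_real (sin (a * t) / a)"
proof -
  let ?F = "\<lambda>s. Complex (sin (a * s) / a) (cos (a * s) / a)"
  have F: "?F = (\<lambda>s. of_real (sin (a * s) / a) + \<i> * of_real (cos (a * s) / a))"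
    by (auto simp: complex_eq_iff)
  have "(\<integral>s. indicator {-t..t} s *\<^sub>R cis (- (a * s)) \<partial>lborel) = ?F t - ?F (-t)"
  proof (rule integral_FTC_atLeastAtMost)
    fix x
    have c: "cis (- (a * x)) = of_real (cos (a * x)) + \<i> * of_real (- sin (a * x))"
      by (auto simp: complex_eq_iff)
    show "(?F has_vector_derivative cis (- (a * x))) (at x within {-t..t})"
      unfolding F c using a
      by (auto intro!: derivative_eq_intros simp: has_real_derivative_iff_has_vector_derivative[symmetric])
  qed (use t in \<open>auto intro!: continuous_intros\<close>)
  also have "\<dots> = 2 * complex_of_real (sin (a * t) / a)"
    by (simp add: complex_eq_iff)
  finally show ?thesis .
qed

text \<open>The integrand depends on \<open>p\<close> through its component along \<open>\<zeta>\<close> only, so this is the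
  one-dimensional integral of a character over \<open>[-t, t]\<close>.\<close>
lemma fourier_wave_measure:
  fixes \<zeta> :: "real ^ 'n"
  assumes n: "CARD('n) \<in> {1, 2, 3}" and t: "t > 0"
  shows "(\<integral>p. cis (- 2 * pi * (p \<bullet> \<zeta>)) \<partial>wave_measure t) = complex_of_real (wave_symbol t \<zeta>)"
proof (cases "\<zeta> = 0")
  case True
  have "measure (wave_measure t :: (real ^ 'n) measure) UNIV = t"
    using emeasure_wave_measure_UNIV[OF n t] t by (simp add: measure_def)
  with True show ?thesis
    by (simp add: wave_symbol_def sets_eq_imp_space_eq[OF sets_wave_measure] of_real_def)
next
  case False
  define e where "e = (1 / norm \<zeta>) *\<^sub>R \<zeta>"
  define a where "a = 2 * pi * norm \<zeta>"
  have e: "norm e = 1" and a: "a \<noteq> 0" using False by (auto simp: e_def a_def)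
  have "(\<integral>p. cis (- 2 * pi * (p \<bullet> \<zeta>)) \<partial>wave_measure t) = (\<integral>p. cis (- (a * (p \<bullet> e))) \<partial>wave_measure t)"
    using False by (simp add: e_def a_def mult.assoc)
  also have "\<dots> = (\<integral>s. cis (- (a * s)) \<partial>distr (wave_measure t) borel (\<lambda>p. p \<bullet> e))"
    by (subst integral_distr) auto
  also have "\<dots> = (\<integral>s. (indicator {-t..t} s / 2) *\<^sub>R cis (- (a * s)) \<partial>lborel)"
    unfolding distr_wave_measure_inner[OF n t e] by (subst integral_density) auto
  also have "\<dots> = (\<integral>s. (1 / 2) *\<^sub>R (indicator {-t..t} s *\<^sub>R cis (- (a * s))) \<partial>lborel)"
    by simp
  also have "\<dots> = (1 / 2) *\<^sub>R (2 * complex_of_real (sin (a * t) / a))"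
    by (subst integral_scaleR_right) (simp only: integral_cis_interval[OF a t])
  also have "\<dots> = complex_of_real (wave_symbol t \<zeta>)"
    using False by (simp add: wave_symbol_def a_def scaleR_conv_of_real)
  finally show ?thesis .
qed

section \<open>The Fourier transform of a Gaussian\<close>

lemma
  fixes F :: "'a::euclidean_space \<Rightarrow> real \<Rightarrow> complex"
  assumes "\<And>b. b \<in> Basis \<Longrightarrow> integrable lborel (F b)"
  shows integrable_lborel_prod: "integrable lborel (\<lambda>u::'a. \<Prod>b\<in>Basis. F b (u \<bullet> b))" (is ?I)
    and integral_lborel_prod: "(\<integral>u. (\<Prod>b\<in>Basis. F b (u \<bullet> b)) \<partial>(lborel :: 'a measure)) = (\<Prod>b\<in>Basis. \<integral>s. F b s \<partial>lborel)" (is ?E)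
proof -
  interpret product_sigma_finite "\<lambda>_::'a. lborel :: real measure" ..
  have [measurable]: "F b \<in> borel_measurable borel" if "b \<in> Basis" for b
    using borel_measurable_integrable[OF assms[OF that]] by simp
  have *: "(\<Prod>b\<in>Basis. F b ((\<Sum>b\<in>Basis. f b *\<^sub>R b) \<bullet> b)) = (\<Prod>b\<in>Basis. F b (f b))" for f
    by (intro prod.cong refl) (simp add: inner_sum_left inner_Basis if_distrib cong: if_cong)
  show ?I unfolding lborel_eq[where 'a='a]
    by (subst integrable_distr_eq) (auto simp: * intro!: product_integrable_prod assms)
  show ?E unfolding lborel_eq[where 'a='a]
    by (subst integral_distr) (auto simp: * intro!: product_integral_prod assms)
qed

text \<open>The substitution \<open>x = sqrt (2 * pi * a) * s\<close> turns the characteristic function of the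
  standard normal distribution into the Fourier transform in the normalization with \<open>2 * pi\<close> in the
  exponent.\<close>
lemma
  assumes a: "a > 0"
  shows integrable_gaussian_real: "integrable lborel (\<lambda>s::real. exp (- (a * pi * s\<^sup>2)))"
    and fourier_gaussian_real: "(\<integral>s. complex_of_real (exp (- (a * pi * s\<^sup>2))) * cis (2 * pi * (s * z)) \<partial>lborel)
      = complex_of_real (exp (- (pi * z\<^sup>2 / a)) / sqrt a)"
proof -
  define c where "c = sqrt (2 * pi * a)"
  have c: "c > 0" "c\<^sup>2 = 2 * pi * a" using a by (auto simp: c_def)
  have n: "std_normal_density (c * s) = (1 / sqrt (2 * pi)) * exp (- (a * pi * s\<^sup>2))" for s
    by (simp add: std_normal_density_def power_mult_distrib c mult_ac)
  have "integrable lborel (\<lambda>s. std_normal_density (0 + c * s))"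
    by (rule lborel_integrable_real_affine) (use c in auto)
  from integrable_mult_right[OF this, of "sqrt (2 * pi)"]
  show "integrable lborel (\<lambda>s::real. exp (- (a * pi * s\<^sup>2)))"
    by (simp add: n)
  define T where "T = 2 * pi * z / c"
  have "complex_of_real (exp (- (T\<^sup>2) / 2)) = (\<integral>x. iexp (T * x) \<partial>std_normal_distribution)"
    using fun_cong[OF char_std_normal_distribution, of T] by (simp add: char_def)
  also have "\<dots> = (\<integral>x. std_normal_density x *\<^sub>R iexp (T * x) \<partial>lborel)"
    by (subst integral_density) (auto intro!: normal_density_nonneg)
  also have "\<dots> = \<bar>c\<bar> *\<^sub>R (\<integral>s. std_normal_density (0 + c * s) *\<^sub>R iexp (T * (0 + c * s)) \<partial>lborel)"
    by (rule lborel_integral_real_affine) (use c in auto)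
  also have "\<dots> = c *\<^sub>R (\<integral>s. (1 / sqrt (2 * pi)) *\<^sub>R (complex_of_real (exp (- (a * pi * s\<^sup>2))) * cis (2 * pi * (s * z))) \<partial>lborel)"
  proof -
    have "std_normal_density (0 + c * s) *\<^sub>R iexp (T * (0 + c * s))
        = (1 / sqrt (2 * pi)) *\<^sub>R (complex_of_real (exp (- (a * pi * s\<^sup>2))) * cis (2 * pi * (s * z)))" for s
    proof -
      have "T * (0 + c * s) = 2 * pi * (s * z)" using c by (simp add: T_def)
      then have "iexp (T * (0 + c * s)) = cis (2 * pi * (s * z))" by (simp only: cis_conv_exp)
      then show ?thesis by (simp only:) (simp add: n scaleR_conv_of_real)
    qed
    then show ?thesis using c by simp
  qed
  also have "\<dots> = (c / sqrt (2 * pi)) *\<^sub>R (\<integral>s. complex_of_real (exp (- (a * pi * s\<^sup>2))) * cis (2 * pi * (s * z)) \<partial>lborel)"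
    by (subst integral_scaleR_right) simp
  also have "c / sqrt (2 * pi) = sqrt a" by (simp add: c_def real_sqrt_mult)
  finally have "complex_of_real (exp (- (T\<^sup>2) / 2)) = sqrt a *\<^sub>R (\<integral>s. complex_of_real (exp (- (a * pi * s\<^sup>2))) * cis (2 * pi * (s * z)) \<partial>lborel)" .
  moreover have "T\<^sup>2 / 2 = pi * z\<^sup>2 / a"
    using a c by (simp add: T_def power_divide power_mult_distrib field_simps power2_eq_square)
  ultimately show "(\<integral>s. complex_of_real (exp (- (a * pi * s\<^sup>2))) * cis (2 * pi * (s * z)) \<partial>lborel)
      = complex_of_real (exp (- (pi * z\<^sup>2 / a)) / sqrt a)"
    using a by (simp add: scaleR_conv_of_real field_simps)
qed

lemma cis_sum: "finite A \<Longrightarrow> cis (\<Sum>i\<in>A. f i) = (\<Prod>i\<in>A. cis (f i))"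
  by (induction A rule: finite_induct) (auto simp: cis_mult[symmetric])

lemma
  fixes \<zeta> :: "'a::euclidean_space"
  assumes a: "a > 0"
  shows integrable_gaussian: "integrable lborel (\<lambda>u::'a. exp (- (a * pi * (norm u)\<^sup>2)))"
    and fourier_gaussian: "(\<integral>u. complex_of_real (exp (- (a * pi * (norm u)\<^sup>2))) * cis (2 * pi * (u \<bullet> \<zeta>)) \<partial>lborel)
      = complex_of_real (exp (- (pi * (norm \<zeta>)\<^sup>2 / a)) / sqrt a ^ DIM('a))"
proof -
  have n: "(norm u)\<^sup>2 = (\<Sum>b\<in>Basis. (u \<bullet> b)\<^sup>2)" for u :: 'a
    by (simp add: norm_eq_sqrt_inner euclidean_inner[of u u] sum_nonneg power2_eq_square)
  let ?F = "\<lambda>b s. complex_of_real (exp (- (a * pi * s\<^sup>2))) * cis (2 * pi * (s * (\<zeta> \<bullet> b)))"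
  have I: "integrable lborel (?F b)" for b
    by (rule Bochner_Integration.integrable_bound[OF integrable_gaussian_real[OF a]]) (auto simp: norm_mult)
  have prod: "complex_of_real (exp (- (a * pi * (norm u)\<^sup>2))) * cis (2 * pi * (u \<bullet> \<zeta>)) = (\<Prod>b\<in>Basis. ?F b (u \<bullet> b))" for u :: 'a
    unfolding n euclidean_inner[of u \<zeta>]
    by (simp add: sum_distrib_left sum_negf[symmetric] exp_sum cis_sum prod.distrib del: sum_negf)
  have "integrable lborel (\<lambda>u::'a. complex_of_real (exp (- (a * pi * (norm u)\<^sup>2))) * cis (2 * pi * (u \<bullet> \<zeta>)))"
    unfolding prod by (rule integrable_lborel_prod) (rule I)
  from integrable_norm[OF this] show "integrable lborel (\<lambda>u::'a. exp (- (a * pi * (norm u)\<^sup>2)))"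
    by (simp add: norm_mult)
  have "(\<integral>u. complex_of_real (exp (- (a * pi * (norm u)\<^sup>2))) * cis (2 * pi * (u \<bullet> \<zeta>)) \<partial>lborel)
     = (\<Prod>b\<in>(Basis::'a set). complex_of_real (exp (- (pi * (\<zeta> \<bullet> b)\<^sup>2 / a)) / sqrt a))"
    unfolding prod by (subst integral_lborel_prod[OF I]) (simp only: fourier_gaussian_real[OF a])
  also have "\<dots> = complex_of_real (exp (- (pi * (norm \<zeta>)\<^sup>2 / a)) / sqrt a ^ DIM('a))"
    unfolding n
    by (simp add: prod_dividef sum_distrib_left sum_divide_distrib sum_negf[symmetric] exp_sum del: sum_negf)
  finally show "(\<integral>u. complex_of_real (exp (- (a * pi * (norm u)\<^sup>2))) * cis (2 * pi * (u \<bullet> \<zeta>)) \<partial>lborel)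
      = complex_of_real (exp (- (pi * (norm \<zeta>)\<^sup>2 / a)) / sqrt a ^ DIM('a))" .
qed

lemma integral_lborel_translate:
  fixes f :: "'a::euclidean_space \<Rightarrow> 'b::{banach, second_countable_topology}"
  assumes [measurable]: "f \<in> borel_measurable borel"
  shows "(\<integral>u. f (u - c) \<partial>lborel) = (\<integral>u. f u \<partial>lborel)"
proof -
  have "(\<integral>u. f u \<partial>lborel) = (\<integral>u. f u \<partial>distr lborel borel ((+) (-c)))" by (simp only: lborel_distr_plus)
  also have "\<dots> = (\<integral>u. f (u - c) \<partial>lborel)" by (subst integral_distr) auto
  finally show ?thesis by simp
qed

lemma integrable_lborel_translate:
  fixes f :: "'a::euclidean_space \<Rightarrow> 'b::{banach, second_countable_topology}"
  assumes "integrable lborel f"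
  shows "integrable lborel (\<lambda>u. f (u - c))"
proof -
  have [measurable]: "f \<in> borel_measurable borel" using borel_measurable_integrable[OF assms] by simp
  have "integrable (distr lborel borel ((+) (-c))) f" using assms by (simp only: lborel_distr_plus)
  then show ?thesis by (subst (asm) integrable_distr_eq) auto
qed

lemma
  fixes \<zeta> c :: "'a::euclidean_space"
  assumes a: "a > 0"
  shows integrable_gaussian_translate: "integrable lborel (\<lambda>u. exp (- (a * pi * (norm (u - c))\<^sup>2)))"
    and fourier_gaussian_translate:
      "(\<integral>u. complex_of_real (exp (- (a * pi * (norm (u - c))\<^sup>2))) * cis (2 * pi * (u \<bullet> \<zeta>)) \<partial>lborel)
      = cis (2 * pi * (c \<bullet> \<zeta>)) * complex_of_real (exp (- (pi * (norm \<zeta>)\<^sup>2 / a)) / sqrt a ^ DIM('a))"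
proof -
  show "integrable lborel (\<lambda>u. exp (- (a * pi * (norm (u - c))\<^sup>2)))"
    using integrable_lborel_translate[OF integrable_gaussian[OF a]] .
  have "(\<integral>u. complex_of_real (exp (- (a * pi * (norm (u - c))\<^sup>2))) * cis (2 * pi * (u \<bullet> \<zeta>)) \<partial>lborel)
     = (\<integral>u. cis (2 * pi * (c \<bullet> \<zeta>)) * (complex_of_real (exp (- (a * pi * (norm (u - c))\<^sup>2))) * cis (2 * pi * ((u - c) \<bullet> \<zeta>))) \<partial>lborel)"
  proof (intro Bochner_Integration.integral_cong refl)
    fix u
    have "cis (2 * pi * (u \<bullet> \<zeta>)) = cis (2 * pi * (c \<bullet> \<zeta>)) * cis (2 * pi * ((u - c) \<bullet> \<zeta>))"
      by (simp add: cis_mult inner_diff_left algebra_simps)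
    then show "complex_of_real (exp (- (a * pi * (norm (u - c))\<^sup>2))) * cis (2 * pi * (u \<bullet> \<zeta>))
      = cis (2 * pi * (c \<bullet> \<zeta>)) * (complex_of_real (exp (- (a * pi * (norm (u - c))\<^sup>2))) * cis (2 * pi * ((u - c) \<bullet> \<zeta>)))"
      by (simp only: mult_ac)
  qed
  also have "\<dots> = cis (2 * pi * (c \<bullet> \<zeta>)) * (\<integral>u. complex_of_real (exp (- (a * pi * (norm (u - c))\<^sup>2))) * cis (2 * pi * ((u - c) \<bullet> \<zeta>)) \<partial>lborel)"
    by (rule integral_mult_right_zero)
  also have "(\<integral>u. complex_of_real (exp (- (a * pi * (norm (u - c))\<^sup>2))) * cis (2 * pi * ((u - c) \<bullet> \<zeta>)) \<partial>lborel)
     = (\<integral>u. complex_of_real (exp (- (a * pi * (norm u)\<^sup>2))) * cis (2 * pi * (u \<bullet> \<zeta>)) \<partial>lborel)"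
    by (rule integral_lborel_translate[of "\<lambda>u. complex_of_real (exp (- (a * pi * (norm u)\<^sup>2))) * cis (2 * pi * (u \<bullet> \<zeta>))"]) measurable
  finally show "(\<integral>u. complex_of_real (exp (- (a * pi * (norm (u - c))\<^sup>2))) * cis (2 * pi * (u \<bullet> \<zeta>)) \<partial>lborel)
      = cis (2 * pi * (c \<bullet> \<zeta>)) * complex_of_real (exp (- (pi * (norm \<zeta>)\<^sup>2 / a)) / sqrt a ^ DIM('a))"
    by (simp only: fourier_gaussian[OF a])
qed

section \<open>The wave multiplier as a convolution\<close>

lemma tf_shift_gauss:
  "tf_shift (x, \<xi>) gauss u = complex_of_real (exp (- (1 * pi * (norm (u - x))\<^sup>2))) * cis (2 * pi * (u \<bullet> \<xi>))"
  by (simp add: gauss_def inner_commute)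

lemma fourier_tf_shift_gauss:
  "fourier (tf_shift (x, \<xi>) gauss) \<zeta>
    = complex_of_real (exp (- (1 * pi * (norm (\<zeta> - \<xi>))\<^sup>2))) * cis (- 2 * pi * (x \<bullet> (\<zeta> - \<xi>)))"
proof -
  have "fourier (tf_shift (x, \<xi>) gauss) \<zeta>
      = (\<integral>u. complex_of_real (exp (- (1 * pi * (norm (u - x))\<^sup>2))) * cis (2 * pi * (u \<bullet> (\<xi> - \<zeta>))) \<partial>lborel)"
    unfolding fourier_def tf_shift_gauss mult.assoc cis_mult
    by (intro Bochner_Integration.integral_cong refl) (simp add: inner_diff_right algebra_simps)
  then show ?thesis
    by (simp only: fourier_gaussian_translate[OF zero_less_one])
      (simp add: norm_minus_commute mult.commute inner_diff_right algebra_simps)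
qed

lemma fourier_inversion_tf_shift_gauss:
  "(\<integral>\<zeta>. fourier (tf_shift (x, \<xi>) gauss) \<zeta> * cis (2 * pi * (v \<bullet> \<zeta>)) \<partial>lborel) = tf_shift (x, \<xi>) gauss v"
proof -
  have "(\<integral>\<zeta>. fourier (tf_shift (x, \<xi>) gauss) \<zeta> * cis (2 * pi * (v \<bullet> \<zeta>)) \<partial>lborel)
      = (\<integral>\<zeta>. cis (2 * pi * (x \<bullet> \<xi>)) * (complex_of_real (exp (- (1 * pi * (norm (\<zeta> - \<xi>))\<^sup>2))) * cis (2 * pi * (\<zeta> \<bullet> (v - x)))) \<partial>lborel)"
  proof (intro Bochner_Integration.integral_cong refl)
    fix \<zeta>
    have "cis (- 2 * pi * (x \<bullet> (\<zeta> - \<xi>))) * cis (2 * pi * (v \<bullet> \<zeta>)) = cis (2 * pi * (x \<bullet> \<xi>)) * cis (2 * pi * (\<zeta> \<bullet> (v - x)))"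
      by (simp add: cis_mult inner_diff_right inner_diff_left inner_commute algebra_simps)
    moreover have "(g * a) * b = c * (g * d)" if "a * b = c * d" for a b c d g :: complex
      using that by (metis mult.assoc mult.left_commute)
    ultimately show "fourier (tf_shift (x, \<xi>) gauss) \<zeta> * cis (2 * pi * (v \<bullet> \<zeta>))
      = cis (2 * pi * (x \<bullet> \<xi>)) * (complex_of_real (exp (- (1 * pi * (norm (\<zeta> - \<xi>))\<^sup>2))) * cis (2 * pi * (\<zeta> \<bullet> (v - x))))"
      unfolding fourier_tf_shift_gauss by blast
  qed
  also have "\<dots> = cis (2 * pi * (x \<bullet> \<xi>)) * (cis (2 * pi * (\<xi> \<bullet> (v - x))) * complex_of_real (exp (- (pi * (norm (v - x))\<^sup>2))))"
    by (subst integral_mult_right_zero) (simp only: fourier_gaussian_translate[OF zero_less_one], simp)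
  also have "\<dots> = tf_shift (x, \<xi>) gauss v"
  proof -
    have "cis (2 * pi * (x \<bullet> \<xi>)) * cis (2 * pi * (\<xi> \<bullet> (v - x))) = cis (2 * pi * (v \<bullet> \<xi>))"
      by (simp add: cis_mult inner_diff_right inner_commute algebra_simps)
    moreover have "a * (b * g) = g * c" if "a * b = c" for a b c g :: complex
      using that by (metis mult.assoc mult.commute)
    ultimately show ?thesis unfolding tf_shift_gauss mult_1 by blast
  qed
  finally show ?thesis .
qed

text \<open>The integrability that Fubini's theorem needs: against a finite measure
  it suffices to dominate the integrand in the other variable.\<close>
lemma integrable_pair_dominated:
  fixes F :: "'a \<times> 'b \<Rightarrow> complex" and b :: "'a \<Rightarrow> real"
  assumes "sigma_finite_measure M" "finite_measure N" and F[measurable]: "F \<in> borel_measurable (M \<Otimes>\<^sub>M N)"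
    and b: "integrable M b" and le: "\<And>x y. norm (F (x, y)) \<le> b x"
  shows "integrable (M \<Otimes>\<^sub>M N) F"
proof -
  interpret M: sigma_finite_measure M by fact
  interpret N: finite_measure N by fact
  interpret P: pair_sigma_finite M N ..
  have [measurable]: "b \<in> borel_measurable M" using b by simp
  have "integrable (M \<Otimes>\<^sub>M N) (\<lambda>p. b (fst p))"
    by (rule P.Fubini_integrable) (auto intro!: integrable_mult_right b integrable_norm)
  then show ?thesis
    by (rule Bochner_Integration.integrable_bound) (auto simp: le order.trans[OF le abs_ge_self])
qed

text \<open>Insert the Fourier representation of the symbol into the multiplier integral, exchange the
  integrals, and recognize Fourier inversion at the point \<open>v - p\<close>.\<close>
lemma wave_multiplier_eq_convolution:
  fixes x \<xi> :: "real ^ 'n"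
  assumes n: "CARD('n) \<in> {1, 2, 3}" and t: "t > 0"
  shows "wave_multiplier t (tf_shift (x, \<xi>) gauss) = convolution_measure (tf_shift (x, \<xi>) gauss) (wave_measure t)"
proof
  fix v :: "real ^ 'n"
  let ?f = "tf_shift (x, \<xi>) gauss" and ?\<mu> = "wave_measure t :: (real ^ 'n) measure"
  interpret \<mu>: finite_measure ?\<mu> by (rule finite_wave_measure[OF n t])
  interpret P: pair_sigma_finite lborel ?\<mu> ..
  let ?\<Phi> = "\<lambda>\<zeta> p. fourier ?f \<zeta> * cis (2 * pi * ((v - p) \<bullet> \<zeta>))"
  have [measurable]: "fourier ?f \<in> borel_measurable borel"
    unfolding fourier_tf_shift_gauss[abs_def] by measurable
  have I: "integrable (lborel \<Otimes>\<^sub>M ?\<mu>) (case_prod ?\<Phi>)"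
    by (rule integrable_pair_dominated[OF sigma_finite_lborel \<mu>.finite_measure_axioms _ integrable_gaussian_translate[of 1 \<xi>]])
      (auto simp: norm_mult fourier_tf_shift_gauss)
  have "wave_multiplier t ?f v = (\<integral>\<zeta>. (\<integral>p. ?\<Phi> \<zeta> p \<partial>?\<mu>) \<partial>lborel)"
    unfolding wave_multiplier_def fourier_multiplier_def
  proof (intro Bochner_Integration.integral_cong refl)
    fix \<zeta> :: "real ^ 'n"
    have "(\<integral>p. ?\<Phi> \<zeta> p \<partial>?\<mu>) = (\<integral>p. (fourier ?f \<zeta> * cis (2 * pi * (v \<bullet> \<zeta>))) * cis (- 2 * pi * (p \<bullet> \<zeta>)) \<partial>?\<mu>)"
      unfolding mult.assoc cis_mult
      by (intro Bochner_Integration.integral_cong refl) (simp add: inner_diff_left algebra_simps)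
    also have "\<dots> = fourier ?f \<zeta> * cis (2 * pi * (v \<bullet> \<zeta>)) * complex_of_real (wave_symbol t \<zeta>)"
      by (subst integral_mult_right_zero) (simp only: fourier_wave_measure[OF n t])
    finally show "complex_of_real (wave_symbol t \<zeta>) * fourier ?f \<zeta> * cis (2 * pi * (v \<bullet> \<zeta>)) = (\<integral>p. ?\<Phi> \<zeta> p \<partial>?\<mu>)"
      by (simp only: mult_ac)
  qed
  also have "\<dots> = (\<integral>p. (\<integral>\<zeta>. ?\<Phi> \<zeta> p \<partial>lborel) \<partial>?\<mu>)"
    by (rule P.Fubini_integral[OF I, symmetric])
  also have "\<dots> = convolution_measure ?f ?\<mu> v"
    unfolding convolution_measure_def fourier_inversion_tf_shift_gauss ..
  finally show "wave_multiplier t ?f v = convolution_measure ?f ?\<mu> v" .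
qed

section \<open>Inner products of shifted Gaussians\<close>

text \<open>Up to a factor that is independent of \<open>p\<close>, this is the inner product of a shifted Gaussian,
  translated by \<open>p\<close>, with a second one; \<open>z\<close> is the difference of the positions before the translation
  and \<open>\<sigma>\<close> the sum of the frequencies.\<close>
definition ambiguity_kernel :: "'a::euclidean_space \<Rightarrow> 'a \<Rightarrow> 'a \<Rightarrow> complex"
  where "ambiguity_kernel z \<sigma> p = complex_of_real (exp (- (pi / 2 * (norm (z + p))\<^sup>2))) * cis (- (pi * (p \<bullet> \<sigma>)))"

lemma borel_measurable_ambiguity_kernel[measurable]: "ambiguity_kernel z \<sigma> \<in> borel_measurable borel"
  unfolding ambiguity_kernel_def by measurable

lemma norm_ambiguity_kernel_le: "norm (ambiguity_kernel z \<sigma> p) \<le> 1"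
  by (simp add: ambiguity_kernel_def norm_mult)

lemma parallelogram_midpoint:
  fixes u a b :: "'a::real_inner"
  shows "(norm (u - a))\<^sup>2 + (norm (u - b))\<^sup>2 = 2 * (norm (u - (1 / 2) *\<^sub>R (a + b)))\<^sup>2 + (norm (a - b))\<^sup>2 / 2"
  by (simp add: power2_norm_eq_inner inner_simps inner_commute field_simps)

text \<open>Completing the square at the midpoint \<open>c\<close> of the two centres splits off the Gaussian in their
  difference and leaves the Fourier transform, at \<open>\<xi> - \<eta>\<close>, of a Gaussian of half the variance centred
  at \<open>c\<close>. The displacement by \<open>c\<close> contributes a phase that is linear in \<open>c\<close>, hence affine in \<open>p\<close>.\<close>
lemma inner_translated_tf_shifts:
  fixes x y \<xi> \<eta> p :: "'a::euclidean_space"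
  shows "(\<integral>u. tf_shift (x, \<xi>) gauss (u - p) * cnj (tf_shift (y, \<eta>) gauss u) \<partial>lborel)
    = cis (pi * ((x + y) \<bullet> (\<xi> - \<eta>))) * complex_of_real (exp (- (pi * (norm (\<xi> - \<eta>))\<^sup>2 / 2)) / sqrt 2 ^ DIM('a))
      * ambiguity_kernel (x - y) (\<xi> + \<eta>) p"
proof -
  define c where "c = (1 / 2) *\<^sub>R ((p + x) + y)"
  define K where "K = complex_of_real (exp (- (pi / 2 * (norm (x - y + p))\<^sup>2))) * cis (- (2 * pi * (p \<bullet> \<xi>)))"
  have "(\<integral>u. tf_shift (x, \<xi>) gauss (u - p) * cnj (tf_shift (y, \<eta>) gauss u) \<partial>lborel)
     = (\<integral>u. K * (complex_of_real (exp (- (2 * pi * (norm (u - c))\<^sup>2))) * cis (2 * pi * (u \<bullet> (\<xi> - \<eta>)))) \<partial>lborel)"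
  proof (intro Bochner_Integration.integral_cong refl)
    fix u
    have "(norm (u - p - x))\<^sup>2 + (norm (u - y))\<^sup>2 = 2 * (norm (u - c))\<^sup>2 + (norm (x - y + p))\<^sup>2 / 2"
      using parallelogram_midpoint[of u "p + x" y] by (simp add: c_def algebra_simps)
    then have "pi * ((norm (u - p - x))\<^sup>2 + (norm (u - y))\<^sup>2) = pi * (2 * (norm (u - c))\<^sup>2 + (norm (x - y + p))\<^sup>2 / 2)"
      by (simp only:)
    then have "- (1 * pi * (norm (u - p - x))\<^sup>2) + - (1 * pi * (norm (u - y))\<^sup>2)
        = - (pi / 2 * (norm (x - y + p))\<^sup>2) + - (2 * pi * (norm (u - c))\<^sup>2)"
      by (simp add: algebra_simps)
    then have e: "exp (- (1 * pi * (norm (u - p - x))\<^sup>2)) * exp (- (1 * pi * (norm (u - y))\<^sup>2))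
        = exp (- (pi / 2 * (norm (x - y + p))\<^sup>2)) * exp (- (2 * pi * (norm (u - c))\<^sup>2))"
      by (simp only: exp_add[symmetric])
    have c: "cis (2 * pi * ((u - p) \<bullet> \<xi>)) * cis (- (2 * pi * (u \<bullet> \<eta>))) = cis (- (2 * pi * (p \<bullet> \<xi>))) * cis (2 * pi * (u \<bullet> (\<xi> - \<eta>)))"
      by (simp add: cis_mult inner_diff_left inner_diff_right algebra_simps)
    have r: "(a * b) * (c * d) = (a * c) * (b * d)" for a b c d :: complex by simp
    show "tf_shift (x, \<xi>) gauss (u - p) * cnj (tf_shift (y, \<eta>) gauss u)
      = K * (complex_of_real (exp (- (2 * pi * (norm (u - c))\<^sup>2))) * cis (2 * pi * (u \<bullet> (\<xi> - \<eta>))))"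
      unfolding tf_shift_gauss K_def complex_cnj_mult complex_cnj_complex_of_real cis_cnj
      by (subst (1 2) r) (simp only: of_real_mult[symmetric] e c)
  qed
  also have "\<dots> = K * (cis (2 * pi * (c \<bullet> (\<xi> - \<eta>))) * complex_of_real (exp (- (pi * (norm (\<xi> - \<eta>))\<^sup>2 / 2)) / sqrt 2 ^ DIM('a)))"
    by (subst integral_mult_right_zero) (simp only: fourier_gaussian_translate[OF zero_less_numeral])
  also have "\<dots> = cis (pi * ((x + y) \<bullet> (\<xi> - \<eta>))) * complex_of_real (exp (- (pi * (norm (\<xi> - \<eta>))\<^sup>2 / 2)) / sqrt 2 ^ DIM('a))
      * ambiguity_kernel (x - y) (\<xi> + \<eta>) p"
  proof -
    have "cis (- (2 * pi * (p \<bullet> \<xi>))) * cis (2 * pi * (c \<bullet> (\<xi> - \<eta>)))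
        = cis (pi * ((x + y) \<bullet> (\<xi> - \<eta>))) * cis (- (pi * (p \<bullet> (\<xi> + \<eta>))))"
      by (simp add: cis_mult c_def inner_simps algebra_simps)
    moreover have "(e * a) * (b * g) = (c * g) * (e * d)" if "a * b = c * d" for a b c d e g :: complex
      using that by (simp add: mult_ac)
    ultimately show ?thesis unfolding K_def ambiguity_kernel_def by blast
  qed
  finally show ?thesis .
qed

lemma L2_inner_wave_multiplier:
  fixes x y \<xi> \<eta> :: "real ^ 'n"
  assumes n: "CARD('n) \<in> {1, 2, 3}" and t: "t > 0"
  shows "L2_inner (wave_multiplier t (tf_shift (x, \<xi>) gauss)) (tf_shift (y, \<eta>) gauss)
    = cis (pi * ((x + y) \<bullet> (\<xi> - \<eta>))) * complex_of_real (exp (- (pi * (norm (\<xi> - \<eta>))\<^sup>2 / 2)) / sqrt 2 ^ CARD('n))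
      * (\<integral>p. ambiguity_kernel (x - y) (\<xi> + \<eta>) p \<partial>wave_measure t)"
proof -
  let ?f = "tf_shift (x, \<xi>) gauss" and ?h = "tf_shift (y, \<eta>) gauss" and ?\<mu> = "wave_measure t :: (real ^ 'n) measure"
  interpret \<mu>: finite_measure ?\<mu> by (rule finite_wave_measure[OF n t])
  interpret P: pair_sigma_finite lborel ?\<mu> ..
  have I: "integrable (lborel \<Otimes>\<^sub>M ?\<mu>) (\<lambda>(u, p). ?f (u - p) * cnj (?h u))"
  proof (rule integrable_pair_dominated[OF sigma_finite_lborel \<mu>.finite_measure_axioms _ integrable_gaussian_translate[of 1 y]])
    show "(\<lambda>(u, p). ?f (u - p) * cnj (?h u)) \<in> borel_measurable (lborel \<Otimes>\<^sub>M ?\<mu>)"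
      unfolding tf_shift_gauss complex_cnj_mult complex_cnj_complex_of_real cis_cnj by measurable
  qed (auto simp: norm_mult tf_shift_gauss simp del: tf_shift.simps intro!: mult_left_le_one_le)
  have "L2_inner (wave_multiplier t ?f) ?h = (\<integral>u. (\<integral>p. ?f (u - p) * cnj (?h u) \<partial>?\<mu>) \<partial>lborel)"
    unfolding L2_inner_def wave_multiplier_eq_convolution[OF n t] convolution_measure_def
    by (simp only: integral_mult_left_zero)
  also have "\<dots> = (\<integral>p. (\<integral>u. ?f (u - p) * cnj (?h u) \<partial>lborel) \<partial>?\<mu>)"
    by (rule P.Fubini_integral[OF I, symmetric])
  finally show ?thesis unfolding inner_translated_tf_shifts by simp
qed

section \<open>Midpoint and difference coordinates\<close>

text \<open>The map \<open>(u, r) \<mapsto> (u + r / 2, u - r / 2)\<close> is a composition of shears, each of which is a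
  translation in one variable when the other one is fixed.\<close>
lemma distr_lborel_midpoint_difference:
  "distr (lborel \<Otimes>\<^sub>M lborel) (lborel \<Otimes>\<^sub>M lborel) (\<lambda>(u, r :: 'a::euclidean_space). (u + (1 / 2) *\<^sub>R r, u - (1 / 2) *\<^sub>R r))
    = lborel \<Otimes>\<^sub>M lborel" (is "distr ?L ?L ?T = _")
proof (rule measure_eqI)
  fix A assume "A \<in> sets (distr ?L ?L ?T)"
  then have A[measurable]: "A \<in> sets ?L" by simp
  have T[measurable]: "?T \<in> ?L \<rightarrow>\<^sub>M ?L" by measurable
  have "emeasure (distr ?L ?L ?T) A = (\<integral>\<^sup>+p. indicator A p \<partial>distr ?L ?L ?T)" using A by simp
  also have "\<dots> = (\<integral>\<^sup>+p. indicator A (?T p) \<partial>?L)" by (rule nn_integral_distr[OF T]) simp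
  also have "\<dots> = (\<integral>\<^sup>+r. (\<integral>\<^sup>+u. indicator A (u + (1 / 2) *\<^sub>R r, u - (1 / 2) *\<^sub>R r) \<partial>lborel) \<partial>lborel)"
    by (subst lborel_pair.nn_integral_snd[symmetric]) auto
  also have "\<dots> = (\<integral>\<^sup>+r. (\<integral>\<^sup>+u. indicator A (u + r, u) \<partial>lborel) \<partial>lborel)"
  proof (rule nn_integral_cong)
    fix r :: 'a
    have "(\<integral>\<^sup>+u. indicator A ((u + (1 / 2) *\<^sub>R r) + (1 / 2) *\<^sub>R r, u + (1 / 2) *\<^sub>R r - (1 / 2) *\<^sub>R r) \<partial>lborel)
        = (\<integral>\<^sup>+u. indicator A (u + (1 / 2) *\<^sub>R r, u - (1 / 2) *\<^sub>R r) \<partial>lborel)"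
      by (rule nn_integral_lborel_translate) measurable
    then show "(\<integral>\<^sup>+u. indicator A (u + (1 / 2) *\<^sub>R r, u - (1 / 2) *\<^sub>R r) \<partial>lborel)
        = (\<integral>\<^sup>+u. indicator A (u + r, u) \<partial>lborel)"
      by (simp add: add.assoc flip: scaleR_left_distrib)
  qed
  also have "\<dots> = (\<integral>\<^sup>+u. (\<integral>\<^sup>+r. indicator A (u + r, u) \<partial>lborel) \<partial>lborel)"
    by (rule lborel_pair.Fubini') measurable
  also have "\<dots> = (\<integral>\<^sup>+u. (\<integral>\<^sup>+r. indicator A (r, u) \<partial>lborel) \<partial>lborel)"
  proof (rule nn_integral_cong)
    fix u :: 'a
    show "(\<integral>\<^sup>+r. indicator A (u + r, u) \<partial>lborel) = (\<integral>\<^sup>+r. indicator A (r, u) \<partial>lborel)"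
      using nn_integral_lborel_translate[of "\<lambda>r. indicator A (r, u)" u] by (simp add: add.commute)
  qed
  also have "\<dots> = emeasure ?L A"
    using nn_integral_indicator[OF A] by (subst lborel_pair.nn_integral_snd) auto
  finally show "emeasure (distr ?L ?L ?T) A = emeasure ?L A" .
qed simp

text \<open>The integrand of the final formula, as a function of midpoint \<open>u\<close> and difference \<open>r\<close>; the
  frequency enters as a Fourier variable dual to \<open>r\<close>, as in a Wigner distribution.\<close>
definition wigner_kernel :: "'a::euclidean_space \<Rightarrow> 'a \<Rightarrow> 'a \<times> 'a \<Rightarrow> complex"
  where "wigner_kernel z \<sigma> = (\<lambda>(u, r). complex_of_real (exp (- pi * (norm (z - u))\<^sup>2)) *
     (complex_of_real (exp (- pi / 4 * (norm r)\<^sup>2)) * cis (- 2 * pi * (r \<bullet> ((1 / 2) *\<^sub>R \<sigma>)))))"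

lemma borel_measurable_wigner_kernel[measurable]:
  "wigner_kernel z \<sigma> \<in> borel_measurable (borel \<Otimes>\<^sub>M borel)"
  unfolding wigner_kernel_def by measurable

lemma norm_wigner_kernel_le: "norm (wigner_kernel z \<sigma> w) \<le> 1"
  by (cases w) (auto simp: wigner_kernel_def norm_mult mult_le_one)

text \<open>The parallelogram law separates midpoint and difference. The arguments are reflected so that
  the midpoint enters as \<open>z - u\<close>, and the conjugate is on the factor with \<open>p\<close> so that the difference
  \<open>p - q\<close> keeps its sign; evenness of \<open>\<mu>\<^sub>t\<close> makes the reflection harmless.\<close>
lemma ambiguity_kernel_product:
  "cnj (ambiguity_kernel z \<sigma> (- p)) * ambiguity_kernel z \<sigma> (- q)
    = wigner_kernel z \<sigma> ((1 / 2) *\<^sub>R (p + q), p - q)"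
proof -
  have "pi / 2 * ((norm (z - p))\<^sup>2 + (norm (z - q))\<^sup>2)
      = pi / 2 * (2 * (norm (z - (1 / 2) *\<^sub>R (p + q)))\<^sup>2 + (norm (p - q))\<^sup>2 / 2)"
    by (simp only: parallelogram_midpoint)
  then have "- (pi / 2 * (norm (z + - p))\<^sup>2) + - (pi / 2 * (norm (z + - q))\<^sup>2)
      = - pi * (norm (z - (1 / 2) *\<^sub>R (p + q)))\<^sup>2 + - pi / 4 * (norm (p - q))\<^sup>2"
    by (simp add: algebra_simps)
  then have e: "exp (- (pi / 2 * (norm (z + - p))\<^sup>2)) * exp (- (pi / 2 * (norm (z + - q))\<^sup>2))
      = exp (- pi * (norm (z - (1 / 2) *\<^sub>R (p + q)))\<^sup>2) * exp (- pi / 4 * (norm (p - q))\<^sup>2)"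
    by (simp only: exp_add[symmetric])
  have c: "cis (- (- (pi * (- p \<bullet> \<sigma>)))) * cis (- (pi * (- q \<bullet> \<sigma>))) = cis (- 2 * pi * ((p - q) \<bullet> ((1 / 2) *\<^sub>R \<sigma>)))"
    by (simp add: cis_mult inner_simps algebra_simps)
  have r: "(a * b) * (c * d) = (a * c) * (b * d)" for a b c d :: complex by simp
  show ?thesis
    unfolding ambiguity_kernel_def wigner_kernel_def complex_cnj_mult complex_cnj_complex_of_real cis_cnj split_conv
    by (subst r) (simp only: c of_real_mult[symmetric] e mult.assoc[symmetric])
qed

lemma integral_wave_measure_reflect:
  fixes k :: "real ^ 'n \<Rightarrow> complex"
  assumes [measurable]: "k \<in> borel_measurable borel"
  shows "(\<integral>p. k (- p) \<partial>wave_measure t) = (\<integral>p. k p \<partial>wave_measure t)"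
proof -
  have "(\<integral>p. k p \<partial>wave_measure t) = (\<integral>p. k p \<partial>distr (wave_measure t) borel uminus)"
    by (subst distr_wave_measure_linear_isometry) (auto intro: linear_compose_neg linear_ident)
  also have "\<dots> = (\<integral>p. k (- p) \<partial>wave_measure t)" by (subst integral_distr) auto
  finally show ?thesis by simp
qed

lemma cmod_square_integral_ambiguity_kernel:
  fixes z \<sigma> :: "real ^ 'n"
  assumes n: "CARD('n) \<in> {1, 2, 3}" and t: "t > 0"
  shows "complex_of_real ((cmod (\<integral>p. ambiguity_kernel z \<sigma> p \<partial>wave_measure t))\<^sup>2)
    = (\<integral>w. wigner_kernel z \<sigma> w \<partial>wave_pair_measure t)"
proof -
  let ?\<mu> = "wave_measure t :: (real ^ 'n) measure" and ?k = "ambiguity_kernel z \<sigma>"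
  interpret \<mu>: finite_measure ?\<mu> by (rule finite_wave_measure[OF n t])
  interpret P: pair_sigma_finite ?\<mu> ?\<mu> ..
  have I: "integrable (?\<mu> \<Otimes>\<^sub>M ?\<mu>) (\<lambda>(p, q). cnj (?k (- p)) * ?k (- q))"
  proof (rule integrable_pair_dominated[OF \<mu>.sigma_finite_measure_axioms \<mu>.finite_measure_axioms, where b="\<lambda>_. 1"])
    show "(\<lambda>(p, q). cnj (?k (- p)) * ?k (- q)) \<in> borel_measurable (?\<mu> \<Otimes>\<^sub>M ?\<mu>)"
      unfolding ambiguity_kernel_product by measurable
  qed (auto simp: norm_mult norm_ambiguity_kernel_le mult_le_one)
  have "complex_of_real ((cmod (\<integral>p. ?k p \<partial>?\<mu>))\<^sup>2) = cnj (\<integral>p. ?k (- p) \<partial>?\<mu>) * (\<integral>q. ?k (- q) \<partial>?\<mu>)"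
    by (simp only: integral_wave_measure_reflect[OF borel_measurable_ambiguity_kernel] complex_norm_square mult.commute)
  also have "cnj (\<integral>p. ?k (- p) \<partial>?\<mu>) = (\<integral>p. cnj (?k (- p)) \<partial>?\<mu>)" by simp
  also have "(\<integral>p. cnj (?k (- p)) \<partial>?\<mu>) * (\<integral>q. ?k (- q) \<partial>?\<mu>) = (\<integral>p. (\<integral>q. cnj (?k (- p)) * ?k (- q) \<partial>?\<mu>) \<partial>?\<mu>)"
    by (simp only: integral_mult_right_zero integral_mult_left_zero)
  also have "\<dots> = (\<integral>(p, q). cnj (?k (- p)) * ?k (- q) \<partial>(?\<mu> \<Otimes>\<^sub>M ?\<mu>))"
    using P.integral_fst'[OF I] by simp
  also have "\<dots> = (\<integral>w. wigner_kernel z \<sigma> w \<partial>wave_pair_measure t)"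
    unfolding wave_pair_measure_def ambiguity_kernel_product
    by (subst integral_distr) (auto simp: case_prod_beta')
  finally show ?thesis .
qed

text \<open>In dimensions 1 and 2 the pair measure has a density, and a linear change of variables gives
  the iterated integral. In dimension 2 the density is unbounded and the inner integral may fail to
  exist for individual \<open>u\<close>, such as \<open>u = 0\<close>. Integrability on the product is inherited from the
  finite measure \<open>\<mu>\<^sub>t \<Otimes> \<mu>\<^sub>t\<close>, so Fubini's theorem confines the exceptional \<open>u\<close> to a null set.\<close>
lemma integral_wave_pair_measure_density:
  fixes H :: "(real ^ 'n) \<times> (real ^ 'n) \<Rightarrow> complex"
  assumes n: "CARD('n) \<in> {1, 2}" and t: "t > 0"
    and H[measurable]: "H \<in> borel_measurable (borel \<Otimes>\<^sub>M borel)" and le: "\<And>w. norm (H w) \<le> 1"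
  shows "(\<integral>w. H w \<partial>wave_pair_measure t)
    = (\<integral>u. (\<integral>r. (wave_density t (u + (1 / 2) *\<^sub>R r) * wave_density t (u - (1 / 2) *\<^sub>R r)) *\<^sub>R H (u, r) \<partial>lborel) \<partial>lborel)"
proof -
  let ?\<mu> = "wave_measure t :: (real ^ 'n) measure" and ?m = "wave_density t :: real ^ 'n \<Rightarrow> real"
  let ?L = "lborel \<Otimes>\<^sub>M lborel :: ((real ^ 'n) \<times> (real ^ 'n)) measure"
  let ?S = "\<lambda>(p, q). ((1 / 2) *\<^sub>R (p + q), p - q :: real ^ 'n)"
  let ?T = "\<lambda>(u, r). (u + (1 / 2) *\<^sub>R r, u - (1 / 2) *\<^sub>R r :: real ^ 'n)"
  let ?G = "\<lambda>w. (?m (fst w) * ?m (snd w)) *\<^sub>R H (?S w)"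
  interpret \<mu>: finite_measure ?\<mu> by (rule finite_wave_measure) (use n t in auto)
  have m: "?m y \<ge> 0" for y by (auto simp: wave_density_def)
  have \<mu>: "?\<mu> = density lborel (\<lambda>y. ennreal (?m y))"
    using n by (auto simp: wave_measure_def)
  have \<mu>\<mu>: "?\<mu> \<Otimes>\<^sub>M ?\<mu> = density ?L (\<lambda>w. ennreal (?m (fst w) * ?m (snd w)))"
    unfolding \<mu> using \<mu>.sigma_finite_measure_axioms
    by (subst pair_measure_density) (auto simp: \<mu> m ennreal_mult case_prod_beta' intro!: sigma_finite_lborel)
  have S[measurable]: "?S \<in> ?L \<rightarrow>\<^sub>M borel \<Otimes>\<^sub>M borel" by measurable
  have T[measurable]: "?T \<in> ?L \<rightarrow>\<^sub>M ?L" by measurable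
  have G[measurable]: "?G \<in> borel_measurable ?L" by measurable
  have ST: "?S (?T w) = w" for w
    by (cases w) (simp add: algebra_simps flip: scaleR_left_distrib)
  have "integrable (?\<mu> \<Otimes>\<^sub>M ?\<mu>) (\<lambda>w. H (?S w))"
    by (rule integrable_pair_dominated[OF \<mu>.sigma_finite_measure_axioms \<mu>.finite_measure_axioms, where b="\<lambda>_. 1"])
      (auto simp: le)
  then have "integrable ?L ?G"
    unfolding \<mu>\<mu> by (subst (asm) integrable_density) (auto simp: m)
  then have I: "integrable ?L (\<lambda>w. ?G (?T w))"
    by (subst (asm) distr_lborel_midpoint_difference[symmetric], subst (asm) integrable_distr_eq) auto
  have "(\<integral>w. H w \<partial>wave_pair_measure t) = (\<integral>w. H (?S w) \<partial>(?\<mu> \<Otimes>\<^sub>M ?\<mu>))"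
    unfolding wave_pair_measure_def by (subst integral_distr) auto
  also have "\<dots> = (\<integral>w. ?G w \<partial>?L)"
    unfolding \<mu>\<mu> by (subst integral_density) (auto simp: m)
  also have "\<dots> = (\<integral>w. ?G (?T w) \<partial>?L)"
    by (subst distr_lborel_midpoint_difference[symmetric], subst integral_distr) auto
  also have "\<dots> = (\<integral>u. (\<integral>r. ?G (?T (u, r)) \<partial>lborel) \<partial>lborel)"
    by (rule lborel_pair.integral_fst'[OF I, symmetric])
  also have "\<dots> = (\<integral>u. (\<integral>r. (?m (u + (1 / 2) *\<^sub>R r) * ?m (u - (1 / 2) *\<^sub>R r)) *\<^sub>R H (u, r) \<partial>lborel) \<partial>lborel)"
    using ST by simp
  finally show ?thesis .
qed

theorem theorem6p5:
  fixes t :: real and x \<xi> y \<eta> :: "real ^ 'n"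
  assumes "CARD('n) \<in> {1, 2, 3}" and "t > 0"
  shows "wave_multiplier t (tf_shift (x, \<xi>) gauss) =
      convolution_measure (tf_shift (x, \<xi>) gauss) (wave_measure t) \<and>
    (CARD('n) \<in> {1, 2} \<longrightarrow>
      complex_of_real
        ((cmod (L2_inner (wave_multiplier t (tf_shift (x, \<xi>) gauss)) (tf_shift (y, \<eta>) gauss)))\<^sup>2) =
      complex_of_real (1 / 2 ^ CARD('n) * exp (- pi * (norm (\<xi> - \<eta>))\<^sup>2)) *
        (\<integral>u. complex_of_real (exp (- pi * (norm (x - y - u))\<^sup>2)) *
          (\<integral>r. complex_of_real (exp (- pi / 4 * (norm r)\<^sup>2)
                  * wave_density t (u + (1 / 2) *\<^sub>R r) * wave_density t (u - (1 / 2) *\<^sub>R r))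
                * cis (- 2 * pi * (r \<bullet> ((1 / 2) *\<^sub>R (\<xi> + \<eta>)))) \<partial>lborel)
        \<partial>lborel)) \<and>
    (CARD('n) = 3 \<longrightarrow>
      complex_of_real
        ((cmod (L2_inner (wave_multiplier t (tf_shift (x, \<xi>) gauss)) (tf_shift (y, \<eta>) gauss)))\<^sup>2) =
      complex_of_real (1 / 2 ^ CARD('n) * exp (- pi * (norm (\<xi> - \<eta>))\<^sup>2)) *
        (\<integral>(u, r). complex_of_real (exp (- pi * (norm (x - y - u))\<^sup>2)) *
              (complex_of_real (exp (- pi / 4 * (norm r)\<^sup>2))
                * cis (- 2 * pi * (r \<bullet> ((1 / 2) *\<^sub>R (\<xi> + \<eta>)))))
        \<partial>wave_pair_measure t))"
proof (intro conjI impI)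
  let ?f = "tf_shift (x, \<xi>) gauss" and ?h = "tf_shift (y, \<eta>) gauss"
  let ?W = "wigner_kernel (x - y) (\<xi> + \<eta>)"
  show "wave_multiplier t ?f = convolution_measure ?f (wave_measure t)"
    by (rule wave_multiplier_eq_convolution[OF assms])
  have key: "complex_of_real ((cmod (L2_inner (wave_multiplier t ?f) ?h))\<^sup>2)
    = complex_of_real (1 / 2 ^ CARD('n) * exp (- pi * (norm (\<xi> - \<eta>))\<^sup>2)) * (\<integral>w. ?W w \<partial>wave_pair_measure t)"
  proof -
    have "(exp (- (pi * (norm (\<xi> - \<eta>))\<^sup>2 / 2)) / sqrt 2 ^ CARD('n))\<^sup>2 = 1 / 2 ^ CARD('n) * exp (- pi * (norm (\<xi> - \<eta>))\<^sup>2)"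
      by (simp add: power_divide power2_eq_square flip: exp_add power_mult_distrib)
    then show ?thesis
      unfolding L2_inner_wave_multiplier[OF assms] norm_mult norm_cis norm_of_real power_mult_distrib power2_abs mult_1 one_power2
        of_real_mult[of "_\<^sup>2"] cmod_square_integral_ambiguity_kernel[OF assms] by (simp only:)
  qed
  show "complex_of_real ((cmod (L2_inner (wave_multiplier t ?f) ?h))\<^sup>2)
    = complex_of_real (1 / 2 ^ CARD('n) * exp (- pi * (norm (\<xi> - \<eta>))\<^sup>2)) *
        (\<integral>(u, r). complex_of_real (exp (- pi * (norm (x - y - u))\<^sup>2)) *
              (complex_of_real (exp (- pi / 4 * (norm r)\<^sup>2))
                * cis (- 2 * pi * (r \<bullet> ((1 / 2) *\<^sub>R (\<xi> + \<eta>)))))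
        \<partial>wave_pair_measure t)"
    using key unfolding wigner_kernel_def .
  assume n: "CARD('n) \<in> {1, 2}"
  have "(\<integral>w. ?W w \<partial>wave_pair_measure t)
    = (\<integral>u. (\<integral>r. complex_of_real (exp (- pi * (norm (x - y - u))\<^sup>2)) * (complex_of_real (exp (- pi / 4 * (norm r)\<^sup>2)
                  * wave_density t (u + (1 / 2) *\<^sub>R r) * wave_density t (u - (1 / 2) *\<^sub>R r))
                * cis (- 2 * pi * (r \<bullet> ((1 / 2) *\<^sub>R (\<xi> + \<eta>))))) \<partial>lborel) \<partial>lborel)"
    (is "_ = ?rhs")
  proof -
    have "(\<integral>w. ?W w \<partial>wave_pair_measure t)
      = (\<integral>u. (\<integral>r. (wave_density t (u + (1 / 2) *\<^sub>R r) * wave_density t (u - (1 / 2) *\<^sub>R r)) *\<^sub>R ?W (u, r) \<partial>lborel) \<partial>lborel)"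
      by (rule integral_wave_pair_measure_density[OF n assms(2) borel_measurable_wigner_kernel norm_wigner_kernel_le])
    also have "\<dots> = ?rhs"
      unfolding wigner_kernel_def split_conv scaleR_conv_of_real of_real_mult
      by (intro Bochner_Integration.integral_cong refl) (simp only: mult_ac)
    finally show ?thesis .
  qed
  then show "complex_of_real ((cmod (L2_inner (wave_multiplier t ?f) ?h))\<^sup>2)
    = complex_of_real (1 / 2 ^ CARD('n) * exp (- pi * (norm (\<xi> - \<eta>))\<^sup>2)) *
        (\<integral>u. complex_of_real (exp (- pi * (norm (x - y - u))\<^sup>2)) *
          (\<integral>r. complex_of_real (exp (- pi / 4 * (norm r)\<^sup>2)
                  * wave_density t (u + (1 / 2) *\<^sub>R r) * wave_density t (u - (1 / 2) *\<^sub>R r))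
                * cis (- 2 * pi * (r \<bullet> ((1 / 2) *\<^sub>R (\<xi> + \<eta>)))) \<partial>lborel)
        \<partial>lborel)"
    unfolding key by (simp only: integral_mult_right_zero)
qed

end
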